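(* Every completely positive $6\times 6$ matrix $M$ satisfies $\mathrm{cpr}\,M\le 15$; that is, $p_6\le 15$.
   Context: An $n\times n$ matrix $M$ is completely positive if $M=VV^\top$ for some entrywise nonnegative, not necessarily square, matrix $V$. The cp-rank $\mathrm{cpr}\,M$ of a nonzero completely positive matrix $M$ is the minimum number of columns of an entrywise nonnegative $V$ with $M=VV^\top$; $\mathrm{cpr}\,0=0$. $p_n$ is the maximum of $\mathrm{cpr}\,M$ over all completely positive $n\times n$ matrices $M$. *)

theory Defs
  imports "Jordan_Normal_Form.Matrix"
begin

definition nonneg_mat :: "real mat \<Rightarrow> bool" where
  "nonneg_mat V \<longleftrightarrow> (\<forall>i < dim_row V. \<forall>j < dim_col V. 0 \<le> V $$ (i, j))"

definition completely_positive :: "real mat \<Rightarrow> bool" where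
  "completely_positive M \<longleftrightarrow> (\<exists>V. nonneg_mat V \<and> M = V * transpose_mat V)"

(* Only meaningful for completely positive M: otherwise the LEAST ranges over
   no factorization at all and its value is unspecified. *)
definition cp_rank :: "real mat \<Rightarrow> nat" where
  "cp_rank M =
    (if M = 0\<^sub>m (dim_row M) (dim_col M) then 0
     else (LEAST k. \<exists>V. nonneg_mat V \<and> dim_col V = k \<and> M = V * transpose_mat V))"

(* The number usually written p_n. Max is unspecified on infinite sets, so a
   bound on max_cp_rank n carries the intended meaning only together with
   boundedness of cp_rank on the completely positive n x n matrices. *)
definition max_cp_rank :: "nat \<Rightarrow> nat" where
  "max_cp_rank n = Max {cp_rank M | M. M \<in> carrier_mat n n \<and> completely_positive M}"

end

theory Submission
  imports Defs "HOL-Analysis.Analysis"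
begin

text \<open>A minimal factorization \<open>M = \<Sum>i. x\<^sub>i x\<^sub>i\<^sup>T\<close> has linearly independent summands, so it suffices to put
  the summands into a space of dimension 15, that is, to find 6 independent linear equations for them
  in the 21-dimensional space of symmetric matrices. If \<open>M\<close> is orthogonal to a copositive \<open>B\<close>, each
  \<open>x\<^sub>i\<close> is a zero of \<open>B\<close> and satisfies \<open>(B x\<^sub>i)\<^sub>k (x\<^sub>i)\<^sub>k = 0\<close> for all \<open>k\<close>; the \<open>k\<close>-th equation is the only one
  that involves the \<open>k\<close>-th diagonal entry, so those with \<open>B\<^sub>k\<^sub>k \<noteq> 0\<close> are independent. A kernel vector of \<open>M\<close>
  also gives 6 equations, and each zero entry of \<open>M\<close> gives one.

  To reach such a \<open>B\<close>, apply the shear \<open>x\<^sub>i \<mapsto> x\<^sub>i - s x\<^sub>j\<close> to \<open>M\<close> until it is about to leave the completely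
  positive cone. The inverse shear is entrywise nonnegative, so the cp-rank of the boundary matrix is at
  least that of \<open>M\<close>. If \<open>M\<close> has few zero entries, the coordinate \<open>i\<close> can be chosen to meet none of
  them; for 3 to 5 zero pairs a diagonal entry is decreased instead, at the cost of one summand.
  For a nonsingular boundary matrix the number of \<open>k\<close> with \<open>B\<^sub>k\<^sub>k \<noteq> 0\<close> is large enough,
  except that without zero entries it may be 5; then one more shear, within the face exposed by \<open>B\<close>,
  supplies the missing equation.\<close>

no_notation Matrix.vec_index (infixl "$" 100)
no_notation Matrix.scalar_prod (infix "\<bullet>" 70)
hide_const (open) Matrix.mat Matrix.vec

section \<open>The completely positive cone\<close>

definition outer :: "real^'n \<Rightarrow> real^'n^'n" where
  "outer x = (\<chi> i j. x $ i * x $ j)"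

definition nonneg_vec :: "real^'n \<Rightarrow> bool" where
  "nonneg_vec x \<longleftrightarrow> (\<forall>i. 0 \<le> x $ i)"

text \<open>A family rather than a set of vectors, so that equal summands count separately; the
  inequality on \<open>card I\<close> expresses "cp-rank at most \<open>k\<close>" without
  padding.\<close>

definition cp_le :: "nat \<Rightarrow> real^'n^'n \<Rightarrow> bool" where
  "cp_le k M \<longleftrightarrow> (\<exists>(I::nat set) x. finite I \<and> card I \<le> k \<and> (\<forall>i\<in>I. nonneg_vec (x i))
     \<and> M = (\<Sum>i\<in>I. outer (x i)))"

definition cp_cone :: "(real^'n^'n) set" where
  "cp_cone = {M. \<exists>k. cp_le k M}"

lemma outer_nth [simp]: "outer x $ i $ j = x $ i * x $ j"
  by (simp add: outer_def)

lemma outer_scale: "outer (c *\<^sub>R x) = c\<^sup>2 *\<^sub>R outer x"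
  by (simp add: vec_eq_iff power2_eq_square algebra_simps)

lemma outer_zero [simp]: "outer 0 = 0"
  by (simp add: vec_eq_iff)

lemma nonneg_vec_scale: "0 \<le> c \<Longrightarrow> nonneg_vec x \<Longrightarrow> nonneg_vec (c *\<^sub>R x)"
  by (simp add: nonneg_vec_def)

lemma cp_leI:
  fixes I :: "'i set"
  assumes "finite I" "card I \<le> k" "\<And>i. i \<in> I \<Longrightarrow> nonneg_vec (x i)"
    and M: "M = (\<Sum>i\<in>I. outer (x i))"
  shows "cp_le k M"
proof -
  obtain h where h: "bij_betw h {0..<card I} I"
    using ex_bij_betw_nat_finite[OF assms(1)] by blast
  have "M = (\<Sum>i\<in>{0..<card I}. outer (x (h i)))"
    unfolding M by (rule sum.reindex_bij_betw[OF h, symmetric])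
  moreover have "nonneg_vec (x (h i))" if "i \<in> {0..<card I}" for i
    using assms(3) bij_betwE[OF h] that by blast
  ultimately show ?thesis
    unfolding cp_le_def using assms(2) 
    by (intro exI[of _ "{0..<card I}"] exI[of _ "\<lambda>i. x (h i)"]) auto
qed

lemma cp_leE:
  assumes "cp_le k M"
  obtains I :: "nat set" and x where "finite I" "card I \<le> k" "\<And>i. i \<in> I \<Longrightarrow> nonneg_vec (x i)"
    "M = (\<Sum>i\<in>I. outer (x i))"
  using assms unfolding cp_le_def by blast

lemma cp_coneE:
  assumes "M \<in> cp_cone"
  obtains I :: "nat set" and x where "finite I" "\<And>i. i \<in> I \<Longrightarrow> nonneg_vec (x i)"
    "M = (\<Sum>i\<in>I. outer (x i))"
proof -
  obtain k where "cp_le k M" using assms by (auto simp: cp_cone_def)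
  then show ?thesis using that by (rule cp_leE)
qed

lemma cp_le_add:
  assumes "cp_le k M" "cp_le l N"
  shows "cp_le (k + l) (M + N)"
proof -
  obtain I x where I: "finite (I::nat set)" "card I \<le> k" "\<And>i. i \<in> I \<Longrightarrow> nonneg_vec (x i)"
    "M = (\<Sum>i\<in>I. outer (x i))" by (rule cp_leE[OF assms(1)]) blast
  obtain J y where J: "finite (J::nat set)" "card J \<le> l" "\<And>i. i \<in> J \<Longrightarrow> nonneg_vec (y i)"
    "N = (\<Sum>i\<in>J. outer (y i))" by (rule cp_leE[OF assms(2)]) blast
  show ?thesis
  proof (rule cp_leI[of "I <+> J" _ "case_sum x y"])
    show "M + N = (\<Sum>i\<in>I <+> J. outer (case_sum x y i))"
      using I J by (simp add: sum.Plus)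
  qed (use I J in \<open>auto simp: card_Plus\<close>)
qed

lemma cp_le_outer: "nonneg_vec x \<Longrightarrow> cp_le 1 (outer x)"
  by (rule cp_leI[of "{()}" _ "\<lambda>_. x"]) auto

lemma cp_le_zero: "cp_le 0 0"
  by (rule cp_leI[of "{}"]) auto

lemma cp_le_scale:
  assumes "cp_le k M" "0 \<le> c"
  shows "cp_le k (c *\<^sub>R M)"
proof -
  obtain I x where I: "finite (I::nat set)" "card I \<le> k" "\<And>i. i \<in> I \<Longrightarrow> nonneg_vec (x i)"
    "M = (\<Sum>i\<in>I. outer (x i))" by (rule cp_leE[OF assms(1)]) blast
  show ?thesis
    by (rule cp_leI[of I _ "\<lambda>i. sqrt c *\<^sub>R x i"])
      (use I assms in \<open>auto simp: outer_scale scaleR_sum_right nonneg_vec_scale\<close>)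
qed

lemma cp_cone_add: "M \<in> cp_cone \<Longrightarrow> N \<in> cp_cone \<Longrightarrow> M + N \<in> cp_cone"
  unfolding cp_cone_def using cp_le_add by blast

lemma cp_cone_scale: "M \<in> cp_cone \<Longrightarrow> 0 \<le> c \<Longrightarrow> c *\<^sub>R M \<in> cp_cone"
  unfolding cp_cone_def using cp_le_scale by blast

lemma outer_in_cp_cone: "nonneg_vec x \<Longrightarrow> outer x \<in> cp_cone"
  unfolding cp_cone_def using cp_le_outer by blast

lemma zero_in_cp_cone: "0 \<in> cp_cone"
  unfolding cp_cone_def using cp_le_zero by blast

lemma cp_cone_sum: "finite I \<Longrightarrow> (\<And>i. i \<in> I \<Longrightarrow> f i \<in> cp_cone) \<Longrightarrow> sum f I \<in> cp_cone"
  by (induction I rule: finite_induct) (auto simp: zero_in_cp_cone cp_cone_add)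

lemma cp_cone_sym:
  assumes "M \<in> cp_cone" shows "M $ i $ j = M $ j $ i"
  by (rule cp_coneE[OF assms]) (simp add: mult.commute)

lemma cp_cone_nonneg:
  assumes "M \<in> cp_cone" shows "0 \<le> M $ i $ j"
  by (rule cp_coneE[OF assms]) (auto intro!: sum_nonneg simp: nonneg_vec_def)

lemma trace_outer: "(\<Sum>i\<in>UNIV. outer x $ i $ i) = (norm x)\<^sup>2"
  by (simp add: power2_norm_eq_inner inner_vec_def)

text \<open>The cone is generated by the matrices \<open>outer x\<close> of nonnegative unit
  vectors. Their convex hull is compact and lies in the hyperplane of trace 1, so it misses 0, and
  the conic hull of such a set is closed.\<close>

lemma closed_cp_cone: "closed (cp_cone :: (real^'n^'n) set)"
proof -
  define P :: "(real^'n) set" where "P = {x. nonneg_vec x} \<inter> sphere 0 1"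
  have clP: "closed {x :: real^'n. nonneg_vec x}"
    unfolding nonneg_vec_def by (intro closed_Collect_all closed_Collect_le continuous_intros)
  have cont: "continuous_on P outer"
    unfolding outer_def by (intro continuous_intros)
  have "compact P"
    unfolding P_def using clP by (intro closed_Int_compact) auto
  then have comp: "compact (convex hull (outer ` P))"
    using cont compact_continuous_image compact_convex_hull by blast
  define H where "H = {X :: real^'n^'n. (\<Sum>i\<in>UNIV. X $ i $ i) = 1}"
  have "convex H"
    unfolding convex_def H_def by (auto simp: sum.distrib sum_distrib_left[symmetric])
  moreover have "outer ` P \<subseteq> H"
    by (auto simp: H_def P_def trace_outer simp del: outer_nth)
  ultimately have "convex hull (outer ` P) \<subseteq> H"
    by (simp add: hull_minimal)
  then have no0: "0 \<notin> convex hull (outer ` P)"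
    by (auto simp: H_def)
  have convcp: "convex (cp_cone :: (real^'n^'n) set)"
    unfolding convex_def by (auto intro: cp_cone_add cp_cone_scale)
  have "outer ` P \<subseteq> cp_cone"
    by (auto simp: P_def outer_in_cp_cone)
  then have hull_sub: "convex hull (outer ` P) \<subseteq> cp_cone"
    using convcp by (simp add: hull_minimal)
  have cc: "convex_cone hull (outer ` P) = insert 0 (conic hull (convex hull (outer ` P)))"
    by (rule convex_cone_hull_separate)
  have eq: "cp_cone = convex_cone hull (outer ` P)"
  proof (intro equalityI subsetI)
    fix M :: "real^'n^'n" assume "M \<in> cp_cone"
    then obtain I x where I: "finite (I::nat set)" "\<And>i. i \<in> I \<Longrightarrow> nonneg_vec (x i)"
      "M = (\<Sum>i\<in>I. outer (x i))" by (rule cp_coneE) blast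
    have "outer v \<in> convex_cone hull (outer ` P)" if "nonneg_vec v" for v
    proof (cases "v = 0")
      case True
      then show ?thesis by (simp add: convex_cone_hull_contains_0)
    next
      case False
      define u where "u = (1 / norm v) *\<^sub>R v"
      have "u \<in> P"
        using False that by (auto simp: P_def u_def intro!: nonneg_vec_scale)
      then have "outer u \<in> convex_cone hull (outer ` P)"
        by (simp add: hull_inc)
      moreover have "outer v = (norm v)\<^sup>2 *\<^sub>R outer u"
        unfolding u_def outer_scale using False by (simp add: power_divide)
      ultimately show ?thesis
        by (simp add: convex_cone_hull_mul)
    qed
    note inhull = this
    show "M \<in> convex_cone hull (outer ` P)"
      unfolding I(3) using I(1,2)
      by (induction I rule: finite_induct) (auto intro!: inhull simp: convex_cone_hull_contains_0 intro!: convex_cone_hull_add)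
  next
    fix M assume "M \<in> convex_cone hull (outer ` P)"
    then show "M \<in> cp_cone"
      unfolding cc conic_hull_explicit using hull_sub zero_in_cp_cone by (auto intro: cp_cone_scale)
  qed
  have "closed (conic hull (convex hull (outer ` P)))"
    using closed_conic_hull comp no0 by blast
  then have "closed (insert 0 (conic hull (convex hull (outer ` P))))"
    by (rule closed_insert)
  then show ?thesis unfolding eq cc .
qed

text \<open>Caratheodory's theorem for cones: more than \<open>dim U\<close> summands are linearly
  dependent, and a dependence removes one of them while the weights of the others stay
  nonnegative.\<close>

lemma conical_reduction:
  fixes x :: "'i \<Rightarrow> real^'n"
  assumes "finite I" "\<And>i. i \<in> I \<Longrightarrow> nonneg_vec (x i)" "subspace U"
    and "\<And>i. i \<in> I \<Longrightarrow> outer (x i) \<in> U" "dim U \<le> d"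
  shows "cp_le d (\<Sum>i\<in>I. outer (x i))"
  using assms(1,2,4)
proof (induction "card I" arbitrary: I x rule: less_induct)
  case less
  show ?case
  proof (cases "card I \<le> d")
    case True
    then show ?thesis using less.prems by (intro cp_leI[of I _ x]) auto
  next
    case False
    \<comment> \<open>Dependence is meant for the family, so two equal summands are dependent as
      well.\<close>
    have "\<exists>c. (\<exists>i\<in>I. c i \<noteq> 0) \<and> (\<Sum>i\<in>I. c i *\<^sub>R outer (x i)) = 0"
    proof (cases "inj_on (\<lambda>i. outer (x i)) I")
      case True
      let ?A = "(\<lambda>i. outer (x i)) ` I"
      have "dependent ?A"
      proof (rule ccontr)
        assume "\<not> dependent ?A"
        then have "card ?A \<le> dim U"
          using less.prems(3) by (intro independent_card_le_dim image_subsetI)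
        then show False using True assms(5) False by (simp add: card_image)
      qed
      then obtain u v where uv: "v \<in> ?A" "u v \<noteq> 0" "(\<Sum>v\<in>?A. u v *\<^sub>R v) = 0"
        using less.prems(1) unfolding dependent_finite[OF finite_imageI[OF less.prems(1)]] by blast
      have "(\<Sum>i\<in>I. u (outer (x i)) *\<^sub>R outer (x i)) = 0"
        using uv(3) True by (simp add: sum.reindex)
      then show ?thesis using uv by (intro exI[of _ "\<lambda>i. u (outer (x i))"]) auto
    next
      case False
      then obtain a b where ab: "a \<in> I" "b \<in> I" "a \<noteq> b" "outer (x a) = outer (x b)"
        by (auto simp: inj_on_def)
      let ?c = "\<lambda>i. if i = a then 1 else if i = b then -1 else (0::real)"
      have "(\<Sum>i\<in>I. ?c i *\<^sub>R outer (x i)) = (\<Sum>i\<in>{a,b}. ?c i *\<^sub>R outer (x i))"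
        using ab less.prems by (intro sum.mono_neutral_right) auto
      also have "\<dots> = 0" using ab by simp
      finally show ?thesis using ab by (intro exI[of _ ?c]) auto
    qed
    then obtain c where c: "\<exists>i\<in>I. c i \<noteq> 0" "(\<Sum>i\<in>I. c i *\<^sub>R outer (x i)) = 0" by blast
    obtain c where c: "\<exists>i\<in>I. c i > 0" "(\<Sum>i\<in>I. c i *\<^sub>R outer (x i)) = 0"
    proof (cases "\<exists>i\<in>I. c i > 0")
      case True
      then show ?thesis using c(2) that by blast
    next
      case False
      have "\<exists>i\<in>I. - c i > 0" using c(1) False by (metis neg_0_less_iff_less linorder_neqE)
      moreover have "(\<Sum>i\<in>I. (- c i) *\<^sub>R outer (x i)) = 0"
        using c(2) by (simp add: sum_negf)
      ultimately show ?thesis using that[of "\<lambda>i. - c i"] by blast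
    qed
    obtain m where m: "m \<in> I" "\<And>i. i \<in> I \<Longrightarrow> c i \<le> c m"
    proof -
      have "Max (c ` I) \<in> c ` I" using less.prems(1) c(1) by (intro Max_in) auto
      then obtain m where "m \<in> I" "c m = Max (c ` I)" by auto
      then show ?thesis using that less.prems(1) by auto
    qed
    have cm: "c m > 0" using c(1) m(2) by (metis less_le_trans)
    \<comment> \<open>Subtracting \<open>1 / c m\<close> times the dependence kills the
      \<open>m\<close>-th summand; as \<open>c m\<close> is positive and the largest coefficient, no
      weight becomes negative.\<close>
    define t where "t i = 1 - c i / c m" for i
    have t: "0 \<le> t i" if "i \<in> I" for i
      using m(2)[OF that] cm by (simp add: t_def)
    have "(\<Sum>i\<in>I. outer (x i)) = (\<Sum>i\<in>I. outer (x i)) - (1 / c m) *\<^sub>R (\<Sum>i\<in>I. c i *\<^sub>R outer (x i))"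
      using c(2) by simp
    also have "\<dots> = (\<Sum>i\<in>I. t i *\<^sub>R outer (x i))"
      by (simp add: t_def scaleR_sum_right sum_subtractf scaleR_left_diff_distrib)
    also have "\<dots> = (\<Sum>i\<in>I - {m}. t i *\<^sub>R outer (x i))"
      using m(1) less.prems(1) cm by (simp add: sum.remove[of I m] t_def)
    also have "\<dots> = (\<Sum>i\<in>I - {m}. outer (sqrt (t i) *\<^sub>R x i))"
      using t by (intro sum.cong) (auto simp: outer_scale)
    finally have eq: "(\<Sum>i\<in>I. outer (x i)) = (\<Sum>i\<in>I - {m}. outer (sqrt (t i) *\<^sub>R x i))" .
    show ?thesis unfolding eq
    proof (rule less.hyps)
      show "card (I - {m}) < card I" using m(1) less.prems(1) by (meson card_Diff1_less)
      show "finite (I - {m})" using less.prems(1) by simp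
      show "nonneg_vec (sqrt (t i) *\<^sub>R x i)" if "i \<in> I - {m}" for i
        using that t less.prems(2) by (intro nonneg_vec_scale) auto
      show "outer (sqrt (t i) *\<^sub>R x i) \<in> U" if "i \<in> I - {m}" for i
        using that less.prems(3) assms(3) unfolding outer_scale by (intro subspace_scale) auto
    qed
  qed
qed

section \<open>Dimension counts and supporting functionals\<close>

text \<open>Since the entries at \<open>D\<close> determine the members of \<open>U\<close>, the
  space \<open>U\<close> meets the orthogonal complement of the matching matrix units only in 0; the
  bound follows by counting dimensions.\<close>

lemma dim_le_coordinates:
  fixes U :: "(real^'n^'n) set" and D :: "'n set set"
  assumes U: "subspace U" and sym: "\<And>X i j. X \<in> U \<Longrightarrow> X $ i $ j = X $ j $ i"
    and det: "\<And>X. X \<in> U \<Longrightarrow> (\<And>i j. {i, j} \<in> D \<Longrightarrow> X $ i $ j = 0) \<Longrightarrow> X = 0"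
  shows "dim U \<le> card D"
proof -
  \<comment> \<open>An arbitrary ordering of each position, so that it gets a single matrix unit; a
    singleton gets a diagonal unit.\<close>
  define r where "r s = (SOME p. s = {fst p, snd p})" for s :: "'n set"
  define e where "e s = axis (fst (r s)) (axis (snd (r s)) (1::real))" for s
  have r: "{fst (r {i, j}), snd (r {i, j})} = {i, j}" for i j
    using someI[of "\<lambda>p. {i, j} = {fst p, snd p}" "(i, j)"] unfolding r_def by simp
  have e: "X \<bullet> e {i, j} = X $ i $ j" if "X \<in> U" for X i j
  proof -
    have "X \<bullet> e {i, j} = X $ fst (r {i, j}) $ snd (r {i, j})"
      by (simp add: e_def inner_axis)
    also have "\<dots> = X $ i $ j"
      using r[of i j] sym[OF that] by (auto simp: doubleton_eq_iff)
    finally show ?thesis .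
  qed
  let ?P = "span (e ` D)"
  let ?O = "{y \<in> UNIV. \<forall>x\<in>?P. orthogonal x y}"
  have dO: "dim ?O + dim ?P = DIM(real^'n^'n)"
    using dim_subspace_orthogonal_to_vectors[of ?P UNIV] by auto
  have "?O = {y. \<forall>x\<in>?P. orthogonal x y}" by simp
  then have sO: "subspace ?O" by (simp add: subspace_orthogonal_to_vectors)
  have "U \<inter> ?O = {0}"
  proof (intro equalityI subsetI)
    fix X assume X: "X \<in> U \<inter> ?O"
    have "X = 0"
    proof (rule det)
      fix i j assume "{i, j} \<in> D"
      then have "orthogonal (e {i, j}) X" using X by (auto intro: span_base)
      then show "X $ i $ j = 0" using e[of X i j] X by (simp add: orthogonal_def inner_commute)
    qed (use X in auto)
    then show "X \<in> {0}" by simp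
  qed (use subspace_0[OF U] subspace_0[OF sO] in auto)
  then have "dim U + dim ?O = dim {x + y |x y. x \<in> U \<and> y \<in> ?O}"
    using dim_sums_Int[OF U sO] by simp
  also have "\<dots> \<le> DIM(real^'n^'n)" by (rule dim_subset_UNIV)
  finally have "dim U \<le> dim ?P" using dO by simp
  also have "\<dots> = dim (e ` D)" by simp
  also have "\<dots> \<le> card (e ` D)" by (rule dim_le_card') simp
  also have "\<dots> \<le> card D" by (rule card_image_le) simp
  finally show ?thesis .
qed

definition pairs :: "'n set set" where
  "pairs = {s. card s = 2}"

text \<open>The positions of prescribed zero entries are recorded as a set \<open>F\<close> of two-element index sets;
  the diagonal position \<open>{i, i}\<close> is a singleton and hence never in \<open>F \<subseteq> pairs\<close>.\<close>

definition stable_vecs :: "'n::finite set set \<Rightarrow> (real^'n) set" where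
  "stable_vecs F = {x. nonneg_vec x \<and> (\<forall>i j. {i, j} \<in> F \<longrightarrow> x $ i = 0 \<or> x $ j = 0)}"

lemma pairs_iff [simp]: "{i, j} \<in> pairs \<longleftrightarrow> i \<noteq> j"
  by (auto simp: pairs_def card_insert_if)

lemma card_pairs: "card (pairs :: 'n::finite set set) = CARD('n) choose 2"
  using n_subsets[of "UNIV :: 'n set" 2] by (simp add: pairs_def)

text \<open>Among the equations only that of row \<open>k\<close> contains the \<open>k\<close>-th
  diagonal entry, with coefficient \<open>b k $ k\<close>. So the off-diagonal entries outside
  \<open>F\<close> and the diagonal entries outside \<open>S\<close> determine a solution.\<close>

lemma cp_le_by_rows:
  fixes x :: "'i \<Rightarrow> real^'n" and b :: "'n \<Rightarrow> real^'n"
  assumes I: "finite I" and xF: "\<And>i. i \<in> I \<Longrightarrow> x i \<in> stable_vecs F" and F: "F \<subseteq> pairs"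
    and b: "\<And>k. k \<in> S \<Longrightarrow> b k $ k \<noteq> 0"
    and row: "\<And>i k. i \<in> I \<Longrightarrow> k \<in> S \<Longrightarrow> x i $ k * (b k \<bullet> x i) = 0"
    and d: "(CARD('n) choose 2) + CARD('n) \<le> d + card F + card S"
  shows "cp_le d (\<Sum>i\<in>I. outer (x i))"
proof -
  define U where "U = {X :: real^'n^'n. (\<forall>i j. X $ i $ j = X $ j $ i) \<and> (\<forall>i j. {i, j} \<in> F \<longrightarrow> X $ i $ j = 0)
    \<and> (\<forall>k\<in>S. (\<Sum>l\<in>UNIV. b k $ l * X $ k $ l) = 0)}"
  define D where "D = (pairs - F) \<union> (\<lambda>i. {i}) ` (- S)"
  have U: "subspace U"
    unfolding U_def subspace_def
    by (auto simp: algebra_simps sum.distrib sum_distrib_left[symmetric])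
  have "dim U \<le> card D"
  proof (rule dim_le_coordinates[OF U])
    fix X assume X: "X \<in> U" and XD: "\<And>i j. {i, j} \<in> D \<Longrightarrow> X $ i $ j = 0"
    have off: "X $ i $ j = 0" if "i \<noteq> j" for i j
      using X XD[of i j] that by (cases "{i, j} \<in> F") (auto simp: U_def D_def)
    have "X $ k $ k = 0" for k
    proof (cases "k \<in> S")
      case True
      have "(\<Sum>l\<in>UNIV. b k $ l * X $ k $ l) = b k $ k * X $ k $ k"
        using off by (subst sum.remove[of _ k]) auto
      then show ?thesis using X True b by (auto simp: U_def)
    next
      case False
      then show ?thesis using XD[of k k] by (auto simp: D_def)
    qed
    then show "X = 0" using off by (metis vec_eq_iff zero_index)
  qed (auto simp: U_def)
  also have "card D \<le> card (pairs - F) + card ((\<lambda>i. {i}) ` (- S))"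
    unfolding D_def by (rule card_Un_le)
  also have "\<dots> \<le> d"
  proof -
    have "card (pairs - F) = card (pairs :: 'n set set) - card F"
      using F by (simp add: card_Diff_subset)
    moreover have "card F \<le> card (pairs :: 'n set set)" using F by (simp add: card_mono)
    moreover have "card ((\<lambda>i. {i}) ` (- S)) \<le> card (- S)" by (rule card_image_le) simp
    moreover have "card (- S) = CARD('n) - card S" by (simp add: Compl_eq_Diff_UNIV card_Diff_subset)
    moreover have "card S \<le> CARD('n)" by (simp add: card_mono)
    ultimately show ?thesis using d card_pairs[where 'n='n] by linarith
  qed
  finally have dU: "dim U \<le> d" .
  show ?thesis
  proof (rule conical_reduction[OF I _ U _ dU])
    fix i assume i: "i \<in> I"
    show "nonneg_vec (x i)" using xF[OF i] by (simp add: stable_vecs_def)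
    have "(\<Sum>l\<in>UNIV. b k $ l * (x i $ k * x i $ l)) = x i $ k * (b k \<bullet> x i)" for k
      by (simp add: inner_vec_def sum_distrib_left algebra_simps)
    then show "outer (x i) \<in> U"
      using xF[OF i] row[OF i] by (auto simp: U_def stable_vecs_def mult.commute)
  qed
qed

text \<open>As \<open>v $ k \<noteq> 0\<close>, the equations \<open>X *v v = 0\<close> recover row
  and column \<open>k\<close> from the remaining principal submatrix. No pair of \<open>F\<close>
  contains \<open>k\<close>, so each of them removes one more coordinate there.\<close>

lemma cp_le_by_kernel:
  fixes x :: "'i \<Rightarrow> real^'n"
  assumes I: "finite I" and xF: "\<And>i. i \<in> I \<Longrightarrow> x i \<in> stable_vecs F" and F: "F \<subseteq> pairs"
    and k: "v $ k \<noteq> 0" and kF: "\<And>s. s \<in> F \<Longrightarrow> k \<notin> s"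
    and ker: "\<And>i. i \<in> I \<Longrightarrow> v \<bullet> x i = 0"
    and d: "(CARD('n) - 1 choose 2) + (CARD('n) - 1) \<le> d + card F"
  shows "cp_le d (\<Sum>i\<in>I. outer (x i))"
proof -
  define U where "U = {X :: real^'n^'n. (\<forall>i j. X $ i $ j = X $ j $ i) \<and> (\<forall>i j. {i, j} \<in> F \<longrightarrow> X $ i $ j = 0)
    \<and> (\<forall>i. (\<Sum>l\<in>UNIV. v $ l * X $ i $ l) = 0)}"
  define D where "D = ({s. s \<subseteq> UNIV - {k} \<and> card s = 2} - F) \<union> (\<lambda>i. {i}) ` (UNIV - {k})"
  have U: "subspace U"
    unfolding U_def subspace_def
    by (auto simp: algebra_simps sum.distrib sum_distrib_left[symmetric])
  have "dim U \<le> card D"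
  proof (rule dim_le_coordinates[OF U])
    fix X assume X: "X \<in> U" and XD: "\<And>i j. {i, j} \<in> D \<Longrightarrow> X $ i $ j = 0"
    have off: "X $ i $ j = 0" if "i \<noteq> k" "j \<noteq> k" for i j
      using X XD[of i j] that by (cases "{i, j} \<in> F"; cases "i = j") (auto simp: U_def D_def)
    have ik: "X $ i $ k = 0" if "i \<noteq> k" for i
    proof -
      have "(\<Sum>l\<in>UNIV. v $ l * X $ i $ l) = v $ k * X $ i $ k"
        using off[OF that] by (subst sum.remove[of _ k]) auto
      moreover have "(\<Sum>l\<in>UNIV. v $ l * X $ i $ l) = 0" using X unfolding U_def by blast
      ultimately show ?thesis using k by simp
    qed
    then have ki: "X $ k $ i = 0" if "i \<noteq> k" for i
      using X that by (auto simp: U_def)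
    have "(\<Sum>l\<in>UNIV. v $ l * X $ k $ l) = v $ k * X $ k $ k"
      using ki by (subst sum.remove[of _ k]) auto
    moreover have "(\<Sum>l\<in>UNIV. v $ l * X $ k $ l) = 0" using X unfolding U_def by blast
    ultimately have "X $ k $ k = 0" using k by simp
    then show "X = 0" using off ik ki by (metis vec_eq_iff zero_index)
  qed (auto simp: U_def)
  also have "card D \<le> card ({s. s \<subseteq> UNIV - {k} \<and> card s = 2} - F) + card ((\<lambda>i. {i}) ` (UNIV - {k}))"
    unfolding D_def by (rule card_Un_le)
  also have "\<dots> \<le> d"
  proof -
    have "F \<subseteq> {s. s \<subseteq> UNIV - {k} \<and> card s = 2}"
      using F kF by (auto simp: pairs_def)
    then have "card ({s. s \<subseteq> UNIV - {k} \<and> card s = 2} - F) = (CARD('n) - 1 choose 2) - card F"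
      and "card F \<le> (CARD('n) - 1 choose 2)"
      using n_subsets[of "UNIV - {k}" 2] card_mono[of "{s. s \<subseteq> UNIV - {k} \<and> card s = 2}" F]
      by (auto simp: card_Diff_subset card_Diff_singleton)
    moreover have "card ((\<lambda>i. {i}) ` (UNIV - {k})) \<le> card (UNIV - {k})" by (rule card_image_le) simp
    moreover have "card (UNIV - {k}) = CARD('n) - 1" by (simp add: card_Diff_singleton)
    ultimately show ?thesis using d by linarith
  qed
  finally have dU: "dim U \<le> d" .
  show ?thesis
  proof (rule conical_reduction[OF I _ U _ dU])
    fix i assume i: "i \<in> I"
    show "nonneg_vec (x i)" using xF[OF i] by (simp add: stable_vecs_def)
    have "(\<Sum>l\<in>UNIV. v $ l * (x i $ k * x i $ l)) = x i $ k * (v \<bullet> x i)" for k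
      by (simp add: inner_vec_def sum_distrib_left algebra_simps)
    then show "outer (x i) \<in> U"
      using xF[OF i] ker[OF i] by (auto simp: U_def stable_vecs_def mult.commute)
  qed
qed

text \<open>A curve that leaves \<open>C\<close> within the span of \<open>C\<close> is on the
  relative boundary when it leaves, and there a supporting hyperplane exists that does not contain
  \<open>C\<close>.\<close>

lemma cone_supporting_functional:
  fixes C :: "'a::euclidean_space set" and f :: "real \<Rightarrow> 'a"
  assumes "convex C" and scale: "\<And>X c. X \<in> C \<Longrightarrow> 0 \<le> c \<Longrightarrow> c *\<^sub>R X \<in> C"
    and cont: "isCont f s" and fs: "f s \<in> C"
    and sp: "\<And>t. f t \<in> span C" and out: "\<And>t. t > s \<Longrightarrow> f t \<notin> C"
  obtains a where "\<And>X. X \<in> C \<Longrightarrow> 0 \<le> a \<bullet> X" "a \<bullet> f s = 0" "\<exists>X\<in>C. 0 < a \<bullet> X"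
proof -
  have zero: "0 \<in> C" using scale[OF fs, of 0] by simp
  have "f s \<notin> rel_interior C"
  proof
    assume "f s \<in> rel_interior C"
    then obtain e where e: "e > 0" "ball (f s) e \<inter> affine hull C \<subseteq> C"
      by (auto simp: mem_rel_interior_ball)
    obtain d where d: "d > 0" "\<And>t. dist t s < d \<Longrightarrow> dist (f t) (f s) < e"
      using cont e(1) unfolding continuous_at_eps_delta by blast
    have "f (s + d / 2) \<in> ball (f s) e" 
      using d(2)[of "s + d / 2"] d(1) by (simp add: dist_norm norm_minus_commute)
    moreover have "f (s + d / 2) \<in> affine hull C"
      using sp affine_hull_span_0[of C] zero by (simp add: hull_inc)
    ultimately have "f (s + d / 2) \<in> C" using e(2) by blast
    then show False using out d(1) by (meson half_gt_zero less_add_same_cancel1)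
  qed
  then obtain a where a: "\<And>y. y \<in> C \<Longrightarrow> a \<bullet> f s \<le> a \<bullet> y" "\<And>y. y \<in> rel_interior C \<Longrightarrow> a \<bullet> f s < a \<bullet> y"
    using supporting_hyperplane_rel_boundary[OF assms(1) fs] by metis
  \<comment> \<open>Comparison with the cone points 0 and \<open>2 *\<^sub>R f s\<close> forces the
    supporting value to be 0.\<close>
  have "a \<bullet> f s \<le> 0" using a(1)[OF zero] by simp
  moreover have "a \<bullet> f s \<le> 2 * (a \<bullet> f s)" using a(1)[OF scale[OF fs, of 2]] by simp
  ultimately have z: "a \<bullet> f s = 0" by linarith
  have "rel_interior C \<noteq> {}" using assms(1) zero rel_interior_eq_empty by auto
  then obtain X where "X \<in> rel_interior C" by blast
  then have "X \<in> C" "0 < a \<bullet> X" using a(2) z rel_interior_subset by auto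
  then show ?thesis using that a(1) z by metis
qed

text \<open>The times in \<open>{0..b}\<close> spent in \<open>C\<close> form a compact set, and
  \<open>s\<close> is its maximum.\<close>

lemma last_exit_time:
  fixes C :: "'a::metric_space set" and f :: "real \<Rightarrow> 'a"
  assumes "closed C" and cont: "continuous_on UNIV f" and f0: "f 0 \<in> C"
    and out: "\<And>t. t > b \<Longrightarrow> f t \<notin> C"
  obtains s where "0 \<le> s" "f s \<in> C" "\<And>t. t > s \<Longrightarrow> f t \<notin> C"
proof -
  let ?T = "{0..b} \<inter> f -` C"
  have "0 \<le> b" using f0 out[of 0] by force
  have "closed (f -` C)" using assms(1) cont by (simp add: closed_vimage)
  then have "compact ?T" by (intro compact_Int_closed) auto
  moreover have "0 \<in> ?T" using f0 \<open>0 \<le> b\<close> by simp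
  ultimately obtain s where s: "s \<in> ?T" "\<And>t. t \<in> ?T \<Longrightarrow> t \<le> s"
    using compact_attains_sup[of ?T] by blast
  show ?thesis
  proof (rule that[of s])
    fix t assume "t > s"
    then show "f t \<notin> C" using s(1) s(2)[of t] out[of t] by fastforce
  qed (use s in auto)
qed

section \<open>Zeros of forms that are copositive on a union of faces of the orthant\<close>

abbreviation qform :: "real^'n^'n \<Rightarrow> real^'n \<Rightarrow> real" where
  "qform B x \<equiv> x \<bullet> (B *v x)"

lemma symmetric_form:
  fixes B :: "real^'n^'n"
  assumes "\<And>i j. B $ i $ j = B $ j $ i"
  shows "x \<bullet> (B *v y) = y \<bullet> (B *v x)"
proof -
  have "transpose B = B" using assms by (simp add: vec_eq_iff transpose_def)
  then show ?thesis
    by (metis dot_lmul_matrix inner_commute transpose_matrix_vector)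
qed

lemma qform_add:
  fixes B :: "real^'n^'n"
  assumes "\<And>i j. B $ i $ j = B $ j $ i"
  shows "qform B (x + t *\<^sub>R y) = qform B x + 2 * t * (y \<bullet> (B *v x)) + t\<^sup>2 * qform B y"
  using symmetric_form[OF assms, of x y]
  by (simp add: matrix_vector_right_distrib matrix_vector_mult_scaleR inner_add_left inner_add_right 
     power2_eq_square algebra_simps)

lemma inner_outer: "B \<bullet> outer x = qform B x"
  by (simp add: inner_vec_def matrix_vector_mult_def sum_distrib_left algebra_simps)

lemma quadratic_nonneg_imp_linear_nonneg:
  fixes a b :: real
  assumes "d > 0" "\<And>t. 0 \<le> t \<Longrightarrow> t \<le> d \<Longrightarrow> 0 \<le> 2 * t * a + t\<^sup>2 * b"
  shows "0 \<le> a"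
proof (rule ccontr)
  assume "\<not> 0 \<le> a"
  then have a: "a < 0" by simp
  \<comment> \<open>So small that \<open>t * b \<le> - a\<close>, which gives
    \<open>2 * a + t * b \<le> a < 0\<close>.\<close>
  define t where "t = min d (- a / (\<bar>b\<bar> + 1))"
  have t: "0 < t" "t \<le> d" "t \<le> - a / (\<bar>b\<bar> + 1)"
    using assms(1) a by (auto simp: t_def intro!: divide_neg_pos)
  then have t3: "t * (\<bar>b\<bar> + 1) \<le> - a" by (subst (asm) pos_le_divide_eq) auto
  have "t * b \<le> t * (\<bar>b\<bar> + 1)" using t(1) by (intro mult_left_mono) auto
  then have "2 * a + t * b < 0" using t3 a by linarith
  then have "t * (2 * a + t * b) < 0" using t(1) by (simp add: mult_pos_neg)
  moreover have "0 \<le> 2 * t * a + t\<^sup>2 * b" using assms(2) t by simp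
  ultimately show False by (simp add: power2_eq_square algebra_simps)
qed

lemma stable_mono_support:
  assumes "x \<in> stable_vecs F" "nonneg_vec y" "\<And>i. x $ i = 0 \<Longrightarrow> y $ i = 0"
  shows "y \<in> stable_vecs F"
  using assms by (auto simp: stable_vecs_def)

lemma stable_clique:
  assumes "nonneg_vec y" "\<And>i j. i \<in> K \<Longrightarrow> j \<in> K \<Longrightarrow> {i, j} \<notin> F" "\<And>i. i \<notin> K \<Longrightarrow> y $ i = 0"
  shows "y \<in> stable_vecs F"
  using assms by (auto simp: stable_vecs_def)

lemma stable_nonneg: "x \<in> stable_vecs F \<Longrightarrow> 0 \<le> x $ i"
  by (simp add: stable_vecs_def nonneg_vec_def)

text \<open>Nonnegativity is asked only on the faces of the orthant whose coordinate sets contain no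
  pair of \<open>F\<close>; these forms are dual to the face of the cone with zeros at
  \<open>F\<close>. For \<open>F = {}\<close> this is ordinary copositivity.\<close>

locale copositive_on =
  fixes F :: "'n::finite set set" and B :: "real^'n^'n"
  assumes sym: "B $ i $ j = B $ j $ i"
    and pos: "x \<in> stable_vecs F \<Longrightarrow> 0 \<le> qform B x"
begin

text \<open>The zero \<open>x\<close> minimizes the form along an admissible ray in direction
  \<open>axis k 1\<close>, so the one-sided derivative is nonnegative.\<close>

lemma gradient_nonneg:
  assumes "qform B x = 0" "\<And>t. 0 \<le> t \<Longrightarrow> x + t *\<^sub>R axis k 1 \<in> stable_vecs F"
  shows "0 \<le> (B *v x) $ k"
proof (rule quadratic_nonneg_imp_linear_nonneg[of 1])
  fix t :: real assume "0 \<le> t"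
  then have "0 \<le> qform B (x + t *\<^sub>R axis k 1)" using assms(2) pos by blast
  then show "0 \<le> 2 * t * (B *v x) $ k + t\<^sup>2 * qform B (axis k 1)"
    using assms(1) by (simp add: qform_add[OF sym] inner_axis' )
qed simp

text \<open>At a positive coordinate short steps in both directions are admissible, so the
  derivative vanishes.\<close>

lemma gradient_zero:
  assumes "x \<in> stable_vecs F" "qform B x = 0" "x $ k \<noteq> 0"
  shows "(B *v x) $ k = 0"
proof -
  have xk: "x $ k > 0" using assms(3) stable_nonneg[OF assms(1), of k] by simp
  have "0 \<le> qform B (x + t *\<^sub>R axis k 1)" if "\<bar>t\<bar> \<le> x $ k" for t
  proof (rule pos, rule stable_mono_support[OF assms(1)])
    show "nonneg_vec (x + t *\<^sub>R axis k 1)"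
      using that stable_nonneg[OF assms(1)] by (auto simp: nonneg_vec_def axis_def)
    show "(x + t *\<^sub>R axis k 1) $ i = 0" if "x $ i = 0" for i
      using that assms(3) by (auto simp: axis_def)
  qed
  then have *: "0 \<le> 2 * t * (B *v x) $ k + t\<^sup>2 * qform B (axis k 1)" if "\<bar>t\<bar> \<le> x $ k" for t
    using that assms(2) by (simp add: qform_add[OF sym] inner_axis')
  have "0 \<le> (B *v x) $ k"
    by (rule quadratic_nonneg_imp_linear_nonneg[OF xk, of _ "qform B (axis k 1)"]) (use * in auto)
  moreover have "0 \<le> - (B *v x) $ k"
  proof (rule quadratic_nonneg_imp_linear_nonneg[OF xk])
    show "0 \<le> 2 * t * - (B *v x) $ k + t\<^sup>2 * qform B (axis k 1)" if "0 \<le> t" "t \<le> x $ k" for t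
      using *[of "- t"] that by simp
  qed
  ultimately show ?thesis by simp
qed

text \<open>A short step from \<open>x\<close> along \<open>y\<close> stays in the same face, and
  the linear term vanishes by \<open>gradient_zero\<close>; only
  \<open>e\<^sup>2 * qform B y\<close> is left.\<close>

lemma psd_on_support:
  assumes "x \<in> stable_vecs F" "qform B x = 0" "\<And>i. x $ i = 0 \<Longrightarrow> y $ i = 0"
  shows "0 \<le> qform B y"
proof -
  have bd: "\<exists>e>0. \<forall>i. 0 \<le> (x + e *\<^sub>R y) $ i"
  proof -
    define P where "P = {i. x $ i \<noteq> 0}"
    \<comment> \<open>This keeps \<open>e * \<bar>y $ i\<bar>\<close> below \<open>x $ i\<close> on
      the support; the inserted 1 keeps the minimum defined when the support is empty.\<close>
    define e where "e = Min (insert 1 ((\<lambda>i. x $ i / (\<bar>y $ i\<bar> + 1)) ` P))"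
    have "e > 0" unfolding e_def
      using stable_nonneg[OF assms(1)] by (auto simp: P_def intro!: divide_pos_pos add_nonneg_pos order.not_eq_order_implies_strict)
    moreover have "0 \<le> (x + e *\<^sub>R y) $ i" for i
    proof (cases "i \<in> P")
      case True
      have "e \<le> x $ i / (\<bar>y $ i\<bar> + 1)" unfolding e_def using True by (intro Min_le) auto
      then have "e * (\<bar>y $ i\<bar> + 1) \<le> x $ i" by (simp add: pos_le_divide_eq)
      moreover have "- (e * y $ i) \<le> e * (\<bar>y $ i\<bar> + 1)"
      proof -
        have "e * (- y $ i) \<le> e * (\<bar>y $ i\<bar> + 1)" using \<open>e > 0\<close> by (intro mult_left_mono) auto
        then show ?thesis by simp
      qed
      ultimately show ?thesis by simp
    qed (use assms(3) in \<open>auto simp: P_def\<close>)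
    ultimately show ?thesis by blast
  qed
  then obtain e where e: "e > 0" "\<And>i. 0 \<le> (x + e *\<^sub>R y) $ i" by blast
  have "x + e *\<^sub>R y \<in> stable_vecs F"
    by (rule stable_mono_support[OF assms(1)]) (use e assms(3) in \<open>auto simp: nonneg_vec_def\<close>)
  then have "0 \<le> qform B (x + e *\<^sub>R y)" by (rule pos)
  moreover have "y $ k * (B *v x) $ k = 0" for k
    using gradient_zero[OF assms(1,2), of k] assms(3)[of k] by auto
  then have "y \<bullet> (B *v x) = 0" unfolding inner_vec_def by (intro sum.neutral) auto
  ultimately have "0 \<le> e\<^sup>2 * qform B y" using assms(2) by (simp add: qform_add[OF sym])
  then show ?thesis using e(1) by (simp add: zero_le_mult_iff)
qed

text \<open>If \<open>B\<close> is positive semidefinite on \<open>D\<close>, then two zeros \<open>y\<close>, \<open>z\<close> whose supports exceed \<open>D\<close> by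
  the same index \<open>a\<close> satisfy \<open>z \<bullet> B y \<le> 0\<close>: eliminating \<open>a\<close> gives a vector supported in \<open>D\<close>.\<close>

lemma row_vanishes_on_zeros:
  assumes zer: "\<And>x. x \<in> X \<Longrightarrow> x \<in> stable_vecs F \<and> qform B x = 0"
    and psd: "\<And>y. (\<And>i. i \<notin> D \<Longrightarrow> y $ i = 0) \<Longrightarrow> 0 \<le> qform B y"
    and c: "c \<in> D" and suppS: "\<And>x i. x \<in> X \<Longrightarrow> i \<notin> S \<Longrightarrow> x $ i = 0"
    and edges: "\<And>a b. a \<in> S - D \<Longrightarrow> b \<in> S - D \<Longrightarrow> a \<noteq> b \<Longrightarrow> {a, b} \<in> F"
    and clique: "\<And>a i j. a \<in> S - D \<Longrightarrow> i \<in> insert a D \<Longrightarrow> j \<in> insert a D \<Longrightarrow> {i, j} \<notin> F"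
    and cover: "\<And>a. a \<in> S - D \<Longrightarrow> \<exists>z\<in>X. z $ a \<noteq> 0 \<and> z $ c \<noteq> 0"
    and y: "y \<in> X"
  shows "(B *v y) $ c = 0"
proof (cases "\<exists>a. a \<in> S - D \<and> y $ a \<noteq> 0")
  case True
  then obtain a where a: "a \<in> S - D" "y $ a \<noteq> 0" by blast
  obtain z where z: "z \<in> X" "z $ a \<noteq> 0" "z $ c \<noteq> 0" using cover a by blast
  \<comment> \<open>Distinct indices of \<open>S - D\<close> form pairs of \<open>F\<close>, so a
    stable vector that is nonzero at \<open>a\<close> meets no other of them.\<close>
  have supp: "u $ i = 0" if "u \<in> X" "u $ a \<noteq> 0" "i \<notin> insert a D" for u i
    using zer[OF that(1)] that edges[OF a(1), of i] suppS[OF that(1), of i] by (auto simp: stable_vecs_def)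
  have nn: "0 \<le> y $ i" "0 \<le> z $ i" for i
    using zer[OF y] zer[OF z(1)] stable_nonneg by auto
  \<comment> \<open>This combination cancels coordinate \<open>a\<close>, hence is supported in
    \<open>D\<close>.\<close>
  define w where "w = z $ a *\<^sub>R y + (- y $ a) *\<^sub>R z"
  have "0 \<le> qform B w"
    by (rule psd) (use supp[OF y a(2)] supp[OF z(1,2)] in \<open>force simp: w_def\<close>)
  also have "qform B w = - 2 * ((z $ a * y $ a) * (z \<bullet> (B *v y)))"
    unfolding w_def qform_add[OF sym] using zer[OF y] zer[OF z(1)]
    by (simp add: matrix_vector_mult_scaleR)
  finally have "(z $ a * y $ a) * (z \<bullet> (B *v y)) \<le> 0" by linarith
  moreover have "0 < z $ a * y $ a" using nn[of a] a(2) z(2) by (simp add: zero_less_mult_iff)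
  ultimately have le: "z \<bullet> (B *v y) \<le> 0" by (meson linorder_not_less mult_pos_pos)
  \<comment> \<open>Raising \<open>y\<close> at an index of the clique \<open>insert a D\<close>
    keeps it stable, so every term of \<open>z \<bullet> (B *v y)\<close> is nonnegative; as the sum
    is at most 0, each term vanishes.\<close>
  have tm: "0 \<le> z $ k * (B *v y) $ k" for k
  proof (cases "z $ k = 0")
    case False
    then have k: "k \<in> insert a D" using supp[OF z(1,2)] by blast
    have "0 \<le> (B *v y) $ k"
    proof (rule gradient_nonneg)
      fix t :: real assume "0 \<le> t"
      show "y + t *\<^sub>R axis k 1 \<in> stable_vecs F"
      proof (rule stable_clique)
        show "nonneg_vec (y + t *\<^sub>R axis k 1)"
          using nn \<open>0 \<le> t\<close> by (auto simp: nonneg_vec_def axis_def)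
        show "(y + t *\<^sub>R axis k 1) $ i = 0" if "i \<notin> insert a D" for i
          using that k supp[OF y a(2) that] by (auto simp: axis_def)
      qed (rule clique[OF a(1)])
    qed (use zer[OF y] in auto)
    then show ?thesis using nn by simp
  qed simp
  have "z $ c * (B *v y) $ c \<le> (\<Sum>k\<in>UNIV. z $ k * (B *v y) $ k)"
    using tm by (intro member_le_sum) auto
  also have "\<dots> \<le> 0" using le by (simp add: inner_vec_def)
  finally show ?thesis using tm[of c] z(3) by simp
next
  case False
  then have supp: "y $ i = 0" if "i \<notin> D" for i
    using that suppS[OF y, of i] by blast
  have "0 \<le> qform B (y + t *\<^sub>R axis c 1)" for t
    by (rule psd) (use supp c in \<open>auto simp: axis_def\<close>)
  then have *: "0 \<le> 2 * t * (B *v y) $ c + t\<^sup>2 * qform B (axis c 1)" for t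
    using zer[OF y] by (simp add: qform_add[OF sym] inner_axis')
  have "0 \<le> (B *v y) $ c"
    by (rule quadratic_nonneg_imp_linear_nonneg[of 1 _ "qform B (axis c 1)"]) (use * in auto)
  moreover have "0 \<le> - (B *v y) $ c"
  proof (rule quadratic_nonneg_imp_linear_nonneg[of 1])
    show "0 \<le> 2 * t * - (B *v y) $ c + t\<^sup>2 * qform B (axis c 1)" for t
      using *[of "- t"] by simp
  qed simp
  ultimately show ?thesis by simp
qed

end

section \<open>Supports of forms orthogonal to a nonsingular matrix\<close>

text \<open>\<open>X\<close> stands for the columns of a factorization of a matrix orthogonal to
  \<open>B\<close>: \<open>cover\<close> says that its off-diagonal zeros occur only at
  \<open>F\<close>, and \<open>nondeg\<close> that it is nonsingular.\<close>

locale copositive_zeros = copositive_on F B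
  for F :: "'n::finite set set" and B :: "real^'n^'n" +
  fixes X :: "(real^'n) set"
  assumes F: "F \<subseteq> pairs" and BF: "{i, j} \<in> F \<Longrightarrow> B $ i $ j = 0" and B0: "B \<noteq> 0"
    and zer: "x \<in> X \<Longrightarrow> x \<in> stable_vecs F \<and> qform B x = 0"
    and cover: "i \<noteq> j \<Longrightarrow> {i, j} \<notin> F \<Longrightarrow> \<exists>x\<in>X. x $ i \<noteq> 0 \<and> x $ j \<noteq> 0"
    and nondeg: "v \<noteq> 0 \<Longrightarrow> \<exists>x\<in>X. v \<bullet> x \<noteq> 0"
begin

text \<open>These indices supply the equations for \<open>cp_le_by_rows\<close>. By
  \<open>row_zero\<close> they carry all of \<open>B\<close>.\<close>

definition S where "S = {i. B $ i $ i \<noteq> 0}"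

lemma singleton_notin_F: "{i} \<notin> F"
  using F pairs_iff[of i i] by auto

lemma row_inner: "(B *v x) $ k = B $ k \<bullet> x"
  by (simp add: matrix_vector_mult_def inner_vec_def)

text \<open>If the diagonal entry is 0, then \<open>axis i 1\<close> is a zero of \<open>B\<close>
  and its gradient, row \<open>i\<close>, is nonnegative. This row is also orthogonal to a
  nonnegative vector that is positive at \<open>i\<close> and \<open>j\<close>.\<close>

lemma row_zero:
  assumes "i \<notin> S" shows "B $ i $ j = 0"
proof (cases "i = j \<or> {i, j} \<in> F")
  case True
  then show ?thesis using assms BF by (auto simp: S_def)
next
  case False
  then obtain x where x: "x \<in> X" "x $ i \<noteq> 0" "x $ j \<noteq> 0" using cover by blast
  have ii: "B $ i $ i = 0" using assms by (simp add: S_def)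
  have nn: "0 \<le> B $ i $ k" for k
  proof (cases "{i, k} \<in> F")
    case False
    have "0 \<le> (B *v axis i 1) $ k"
    proof (rule gradient_nonneg)
      show "qform B (axis i 1) = 0"
        using ii by (simp add: matrix_vector_mult_basis inner_axis' column_def)
      fix t :: real assume "0 \<le> t"
      then show "axis i 1 + t *\<^sub>R axis k 1 \<in> stable_vecs F"
        using False singleton_notin_F
        by (intro stable_clique[of _ "{i, k}"]) (auto simp: nonneg_vec_def axis_def insert_commute)
    qed
    then show ?thesis by (simp add: matrix_vector_mult_basis column_def sym)
  qed (simp add: BF)
  have "(B *v x) $ i = 0" using gradient_zero zer[OF x(1)] x(2) by blast
  then have "(\<Sum>k\<in>UNIV. B $ i $ k * x $ k) = 0" by (simp add: matrix_vector_mult_def)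
  moreover have "0 \<le> B $ i $ k * x $ k" for k
    using nn stable_nonneg[OF zer[OF x(1), THEN conjunct1]] by simp
  ultimately have "B $ i $ j * x $ j = 0" by (simp add: sum_nonneg_eq_0_iff)
  then show ?thesis using x(3) by simp
qed

lemma column_zero: "j \<notin> S \<Longrightarrow> B $ i $ j = 0"
  using row_zero sym by metis

lemma S_nonempty: "S \<noteq> {}"
proof
  assume "S = {}"
  then have "B = 0" using row_zero by (simp add: vec_eq_iff)
  then show False using B0 by simp
qed

text \<open>Coordinates outside \<open>S\<close> are invisible to \<open>B\<close>, so cutting them
  off turns zeros into zeros with support in \<open>S\<close>.\<close>

definition restr :: "real^'n \<Rightarrow> real^'n" where
  "restr x = (\<chi> i. if i \<in> S then x $ i else 0)"

lemma mult_restr: "B *v restr x = B *v x"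
proof -
  have "B $ i $ j * restr x $ j = B $ i $ j * x $ j" for i j
    by (simp add: restr_def column_zero)
  then show ?thesis by (simp only: matrix_vector_mult_def)
qed

lemma restr_zero:
  assumes "x \<in> X" shows "restr x \<in> stable_vecs F \<and> qform B (restr x) = 0"
proof
  show "restr x \<in> stable_vecs F"
    by (rule stable_mono_support[of x])
      (use zer[OF assms] stable_nonneg[of x F] in \<open>auto simp: nonneg_vec_def restr_def\<close>)
  have "restr x \<bullet> (B *v x) = x \<bullet> (B *v x)"
    unfolding inner_vec_def restr_def
    by (intro sum.cong) (auto simp: matrix_vector_mult_def row_zero)
  then show "qform B (restr x) = 0" using zer[OF assms] by (simp add: mult_restr)
qed

text \<open>The zero \<open>x\<close> makes \<open>B\<close> semidefinite on \<open>D\<close>, so by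
  \<open>row_vanishes_on_zeros\<close> row \<open>c\<close> is orthogonal to all of
  \<open>X\<close>. By \<open>nondeg\<close> that row would be 0, although its diagonal entry is
  not.\<close>

lemma no_dominating_row:
  assumes D: "D \<subseteq> S" "c \<in> D" and x: "x \<in> X" "\<And>i. i \<in> D \<Longrightarrow> x $ i \<noteq> 0"
    and edges: "\<And>a b. a \<in> S - D \<Longrightarrow> b \<in> S - D \<Longrightarrow> a \<noteq> b \<Longrightarrow> {a, b} \<in> F"
    and clique: "\<And>a i j. a \<in> S - D \<Longrightarrow> i \<in> insert a D \<Longrightarrow> j \<in> insert a D \<Longrightarrow> {i, j} \<notin> F"
  shows False
proof -
  have "(B *v y) $ c = 0" if "y \<in> restr ` X" for y
  proof (rule row_vanishes_on_zeros[where X = "restr ` X" and D = D and S = S])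
    show "0 \<le> qform B u" if "\<And>i. i \<notin> D \<Longrightarrow> u $ i = 0" for u
      using psd_on_support[of x u] zer[OF x(1)] x(2) that by blast
    show "\<exists>z\<in>restr ` X. z $ a \<noteq> 0 \<and> z $ c \<noteq> 0" if "a \<in> S - D" for a
    proof -
      have "{a, c} \<notin> F" using clique[OF that] D by blast
      moreover have "a \<noteq> c" "a \<in> S" "c \<in> S" using that D by auto
      ultimately show ?thesis using cover[of a c] by (auto simp: restr_def)
    qed
    show "u \<in> stable_vecs F \<and> qform B u = 0" if "u \<in> restr ` X" for u
      using that restr_zero by blast
    show "u $ i = 0" if "u \<in> restr ` X" "i \<notin> S" for u i
      using that by (auto simp: restr_def)
    show "{a, b} \<in> F" if "a \<in> S - D" "b \<in> S - D" "a \<noteq> b" for a b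
      by (rule edges[OF that])
    show "{i, j} \<notin> F" if "a \<in> S - D" "i \<in> insert a D" "j \<in> insert a D" for a i j
      by (rule clique[OF that])
  qed (rule D(2), rule that)
  then have "(B *v restr x) $ c = 0" if "x \<in> X" for x
    using that by blast
  then have "B $ c \<bullet> x = 0" if "x \<in> X" for x
    using that by (simp add: mult_restr row_inner)
  moreover have "B $ c \<noteq> 0" using D by (auto simp: S_def)
  ultimately show False using nondeg by blast
qed

text \<open>Otherwise row \<open>a\<close> would have only its diagonal entry, and the gradient of a
  zero that is positive at \<open>a\<close> could not vanish there.\<close>

lemma no_isolated:
  assumes "a \<in> S" shows "\<exists>j\<in>S - {a}. {a, j} \<notin> F"
proof (rule ccontr)
  assume *: "\<not> ?thesis"
  obtain x where x: "x \<in> X" "axis a 1 \<bullet> x \<noteq> 0"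
    using nondeg[of "axis a 1"] by (auto simp: axis_eq_0_iff)
  then have xa: "x $ a \<noteq> 0" by (simp add: inner_axis')
  have "0 = (B *v x) $ a" using gradient_zero zer[OF x(1)] xa by simp
  also have "\<dots> = (\<Sum>j\<in>UNIV. B $ a $ j * x $ j)" by (simp add: matrix_vector_mult_def)
  also have "\<dots> = B $ a $ a * x $ a"
  proof -
    have "B $ a $ j = 0" if "j \<noteq> a" for j
      using * that column_zero[of j a] BF[of a j] by (cases "j \<in> S") auto
    then show ?thesis by (subst sum.remove[of _ a]) auto
  qed
  finally show False using xa assms by (simp add: S_def)
qed

text \<open>With at most one index in \<open>S - D\<close> there are no two distinct indices left
  that would have to form a pair of \<open>F\<close>.\<close>

lemma no_clique_with_large_support:
  assumes nF: "\<And>i j. i \<in> S \<Longrightarrow> j \<in> S \<Longrightarrow> {i, j} \<notin> F"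
    and D: "D \<subseteq> S" "D \<noteq> {}" "card (S - D) \<le> 1" "x \<in> X" "\<And>i. i \<in> D \<Longrightarrow> x $ i \<noteq> 0"
  shows False
proof -
  obtain c where c: "c \<in> D" using D by blast
  show False
  proof (rule no_dominating_row[OF D(1) c D(4,5)])
    show "{a, b} \<in> F" if "a \<in> S - D" "b \<in> S - D" "a \<noteq> b" for a b
      using that D(3) by (metis One_nat_def card_le_Suc0_iff_eq finite)
    show "{i, j} \<notin> F" if "a \<in> S - D" "i \<in> insert a D" "j \<in> insert a D" for a i j
      using nF[of i j] that D(1) by blast
  qed
qed

text \<open>Every two indices of \<open>S\<close> then form the support of a zero, which makes the
  entry of \<open>B\<close> between them negative. So the zero on \<open>{p, q}\<close> has a
  negative gradient at \<open>r\<close>.\<close>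

lemma two_element_supports_impossible:
  assumes nF: "\<And>i j. i \<in> S \<Longrightarrow> j \<in> S \<Longrightarrow> {i, j} \<notin> F"
    and pqr: "p \<in> S" "q \<in> S" "r \<in> S" "p \<noteq> q" "q \<noteq> r" "p \<noteq> r"
    and small: "\<And>x i j k. x \<in> X \<Longrightarrow> {i, j, k} \<subseteq> S \<Longrightarrow> x $ i \<noteq> 0 \<Longrightarrow> x $ j \<noteq> 0 \<Longrightarrow> x $ k \<noteq> 0 \<Longrightarrow>
       i = j \<or> j = k \<or> i = k"
  shows False
proof -
  have ex: "\<exists>x. x \<in> stable_vecs F \<and> qform B x = 0 \<and> x $ i > 0 \<and> x $ j > 0 \<and> (\<forall>k. k \<noteq> i \<longrightarrow> k \<noteq> j \<longrightarrow> x $ k = 0)"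
    if ij: "i \<in> S" "j \<in> S" "i \<noteq> j" for i j
  proof -
    obtain x where x: "x \<in> X" "x $ i \<noteq> 0" "x $ j \<noteq> 0" using cover nF ij by blast
    have st: "restr x \<in> stable_vecs F" "qform B (restr x) = 0" using restr_zero[OF x(1)] by auto
    moreover have "restr x $ k = 0" if "k \<noteq> i" "k \<noteq> j" for k
      using small[OF x(1), of i j k] x ij that by (auto simp: restr_def)
    moreover have "restr x $ i \<noteq> 0" "restr x $ j \<noteq> 0" using x ij by (auto simp: restr_def)
    then have "restr x $ i > 0" "restr x $ j > 0"
      using stable_nonneg[OF st(1), of i] stable_nonneg[OF st(1), of j] by simp_all
    ultimately show ?thesis by blast
  qed
  have row: "(B *v x) $ k = B $ k $ i * x $ i + B $ k $ j * x $ j"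
    if "\<And>k. k \<noteq> i \<Longrightarrow> k \<noteq> j \<Longrightarrow> x $ k = 0" "i \<noteq> j" for x i j k
  proof -
    have "(\<Sum>l\<in>UNIV. B $ k $ l * x $ l) = (\<Sum>l\<in>{i, j}. B $ k $ l * x $ l)"
      using that by (intro sum.mono_neutral_right) auto
    then show ?thesis using that by (simp add: matrix_vector_mult_def)
  qed
  have diag: "B $ i $ i > 0" if "i \<in> S" for i
  proof -
    have "axis i 1 \<in> stable_vecs F"
      using singleton_notin_F by (intro stable_clique[of _ "{i}"]) (auto simp: nonneg_vec_def axis_def)
    then have "0 \<le> qform B (axis i 1)" by (rule pos)
    then show ?thesis using that by (simp add: S_def matrix_vector_mult_basis inner_axis' column_def)
  qed
  have neg: "B $ i $ j < 0" if ij: "i \<in> S" "j \<in> S" "i \<noteq> j" for i j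
  proof -
    obtain x where x: "x \<in> stable_vecs F" "qform B x = 0" "x $ i > 0" "x $ j > 0"
       "\<And>k. k \<noteq> i \<Longrightarrow> k \<noteq> j \<Longrightarrow> x $ k = 0" using ex[OF ij] by blast
    have "B $ i $ i * x $ i + B $ i $ j * x $ j = 0"
      using gradient_zero[OF x(1,2), of i] x(3) row[OF x(5) ij(3)] by simp
    moreover have "B $ i $ i * x $ i > 0" using diag[OF ij(1)] x(3) by simp
    ultimately have "B $ i $ j * x $ j < 0" by linarith
    then show ?thesis using x(4) by (simp add: mult_less_0_iff)
  qed
  obtain x where x: "x \<in> stable_vecs F" "qform B x = 0" "x $ p > 0" "x $ q > 0"
     "\<And>k. k \<noteq> p \<Longrightarrow> k \<noteq> q \<Longrightarrow> x $ k = 0" using ex[OF pqr(1,2,4)] by blast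
  have "0 \<le> (B *v x) $ r"
  proof (rule gradient_nonneg[OF x(2)])
    fix t :: real assume "0 \<le> t"
    then show "x + t *\<^sub>R axis r 1 \<in> stable_vecs F"
      using x nF pqr stable_nonneg[OF x(1)]
      by (intro stable_clique[of _ "{p, q, r}"]) (auto simp: nonneg_vec_def axis_def)
  qed
  moreover have "B $ r $ p * x $ p < 0" "B $ r $ q * x $ q < 0"
    using neg[OF pqr(3,1)] neg[OF pqr(3,2)] pqr x by (auto simp: mult_neg_pos)
  ultimately show False using row[OF x(5) pqr(4), of r] by simp
qed

text \<open>If \<open>S\<close> contains a pair of \<open>F\<close>, it contains only one, and the
  rest of \<open>S\<close> contradicts \<open>no_dominating_row\<close>. If it contains none,
  \<open>no_clique_with_large_support\<close> leaves only \<open>card S = 4\<close> with zeros that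
  meet \<open>S\<close> in at most two indices.\<close>

lemma support_not_small: "\<not> (card S \<le> 3 \<or> card S \<le> 4 \<and> card F \<le> 1)"
proof
  assume small: "card S \<le> 3 \<or> card S \<le> 4 \<and> card F \<le> 1"
  show False
  proof (cases "\<exists>a\<in>S. \<exists>b\<in>S. {a, b} \<in> F")
    case True
    then obtain a b where ab: "a \<in> S" "b \<in> S" "{a, b} \<in> F" by blast
    then have "a \<noteq> b" using singleton_notin_F by auto
    have ba: "{b, a} \<in> F" using ab(3) by (simp add: insert_commute)
    define D where "D = S - {a, b}"
    obtain c where c: "c \<in> S - {a}" "{a, c} \<notin> F" using no_isolated[OF ab(1)] by blast
    then have cD: "c \<in> D" using ab by (auto simp: D_def)
    have cardD: "card D = card S - 2"
      unfolding D_def using ab \<open>a \<noteq> b\<close> by (simp add: card_Diff_subset)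
    have only: "{i, j} = {a, b}" if ij: "i \<in> S" "j \<in> S" "{i, j} \<in> F" for i j
    proof (cases "card F \<le> 1")
      case True
      then show ?thesis using ij ab(3) by (metis One_nat_def card_le_Suc0_iff_eq finite)
    next
      case False
      \<comment> \<open>Here \<open>S\<close> has just the elements \<open>a\<close>,
        \<open>b\<close>, \<open>c\<close>, and \<open>no_isolated\<close> at \<open>a\<close> and
        at \<open>b\<close> excludes the two other pairs.\<close>
      then have "card D \<le> 1" using small cardD by simp
      with cD have Dc: "D = {c}" by (intro card_seteq[symmetric]) auto
      obtain j' where j': "j' \<in> S - {b}" "{b, j'} \<notin> F" using no_isolated[OF ab(2)] by blast
      have "j' \<noteq> a" using j'(2) ba by blast
      then have "j' \<in> D" using j'(1) by (simp add: D_def)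
      then have bc: "{b, c} \<notin> F" using j'(2) Dc by simp
      have cb: "{c, b} \<notin> F" "{c, a} \<notin> F" using bc c(2) by (simp_all add: doubleton_eq_iff insert_commute)
      have "S \<subseteq> {a, b, c}" using Dc unfolding D_def by blast
      then have "i = a \<or> i = b \<or> i = c" "j = a \<or> j = b \<or> j = c" using ij(1,2) by blast+
      then show ?thesis using ij(3) c(2) bc cb singleton_notin_F by auto
    qed
    have nFD: "{i, j} \<notin> F" if "i \<in> insert a' D" "j \<in> insert a' D" "a' \<in> S - D" for a' i j
      using only[of i j] that \<open>a \<noteq> b\<close> by (auto simp: D_def doubleton_eq_iff)
    have "card D \<le> 2" using small cardD by auto
    \<comment> \<open>\<open>D\<close> has at most two elements and contains no pair of
      \<open>F\<close>, so \<open>cover\<close> yields one vector for all of it.\<close>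
    have "\<exists>x\<in>X. \<forall>i\<in>D. x $ i \<noteq> 0"
    proof (cases "\<exists>d\<in>D. d \<noteq> c")
      case True
      then obtain d where d: "d \<in> D" "d \<noteq> c" by blast
      have Dcd: "D = {c, d}"
        using d cD \<open>card D \<le> 2\<close> by (intro card_seteq[symmetric]) auto
      have "a \<in> S - D" using ab(1) by (simp add: D_def)
      then have "{c, d} \<notin> F" using nFD[of c a d] d(1) cD by blast
      then obtain x where "x \<in> X" "x $ c \<noteq> 0" "x $ d \<noteq> 0" using cover[of c d] d(2) by blast
      then show ?thesis unfolding Dcd by blast
    next
      case False
      obtain x where "x \<in> X" "x $ c \<noteq> 0" using cover[of a c] c by blast
      moreover have "i = c" if "i \<in> D" for i using False that by blast
      ultimately show ?thesis by metis
    qed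
    then obtain x where x: "x \<in> X" "\<forall>i\<in>D. x $ i \<noteq> 0" by blast
    show False
    proof (rule no_dominating_row[OF _ cD x(1)])
      show "x $ i \<noteq> 0" if "i \<in> D" for i using x(2) that by blast
      show "{i, j} \<notin> F" if "a' \<in> S - D" "i \<in> insert a' D" "j \<in> insert a' D" for a' i j
        by (rule nFD[OF that(2,3,1)])
      show "{a', b'} \<in> F" if "a' \<in> S - D" "b' \<in> S - D" "a' \<noteq> b'" for a' b'
        using that ab ba by (auto simp: D_def)
    qed (simp add: D_def)
  next
    case False
    then have nF: "{i, j} \<notin> F" if "i \<in> S" "j \<in> S" for i j using that by blast
    have key: False if "D \<subseteq> S" "D \<noteq> {}" "card (S - D) \<le> 1" "x \<in> X" "\<And>i. i \<in> D \<Longrightarrow> x $ i \<noteq> 0" for D x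
      using no_clique_with_large_support[OF _ that] nF by blast
    obtain a where a: "a \<in> S" using S_nonempty by blast
    obtain b where b: "b \<in> S" "b \<noteq> a" using no_isolated[OF a] by blast
    obtain x where x: "x \<in> X" "x $ a \<noteq> 0" "x $ b \<noteq> 0" using cover[of a b] nF a b by blast
    have cardab: "card (S - {a, b}) = card S - 2"
      using a b by (simp add: card_Diff_subset)
    have "\<not> card (S - {a, b}) \<le> 1"
    proof
      assume *: "card (S - {a, b}) \<le> 1"
      show False by (rule key[OF _ _ * x(1)]) (use a b x in auto)
    qed
    then have S4: "card S = 4" using cardab small by linarith
    have "S - {a, b} \<noteq> {}" using S4 cardab by force
    then obtain c where c: "c \<in> S" "c \<noteq> a" "c \<noteq> b" by blast
    \<comment> \<open>In a four-element \<open>S\<close> a zero that is positive at three indices of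
      \<open>S\<close> is excluded by \<open>key\<close>.\<close>
    show False
    proof (rule two_element_supports_impossible[OF _ a b(1) c(1)])
      fix y i j k assume y: "y \<in> X" "{i, j, k} \<subseteq> S" "y $ i \<noteq> 0" "y $ j \<noteq> 0" "y $ k \<noteq> 0"
      show "i = j \<or> j = k \<or> i = k"
      proof (rule ccontr)
        assume "\<not> ?thesis"
        then have "card {i, j, k} = 3" by auto
        then have *: "card (S - {i, j, k}) \<le> 1" using y(2) S4 by (simp add: card_Diff_subset)
        show False by (rule key[OF y(2) _ * y(1)]) (use y in auto)
      qed
    qed (use nF b c in auto)
  qed
qed

lemma card_S: "4 \<le> card S" "card F \<le> 1 \<Longrightarrow> 5 \<le> card S"
  using support_not_small by linarith+

lemma zeros_row: "x \<in> X \<Longrightarrow> x $ k * (B $ k \<bullet> x) = 0"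
  using gradient_zero[of x k] zer[of x] row_inner by auto

end

section \<open>Boundary points of faces of the cone\<close>

definition zero_pairs :: "real^'n::finite^'n \<Rightarrow> 'n set set" where
  "zero_pairs M = {{i, j} | i j. i \<noteq> j \<and> M $ i $ j = 0}"

definition face_cone :: "'n::finite set set \<Rightarrow> (real^'n^'n) set" where
  "face_cone F = {M \<in> cp_cone. \<forall>i j. {i, j} \<in> F \<longrightarrow> M $ i $ j = 0}"

lemma zero_pairs_subset: "zero_pairs M \<subseteq> pairs"
  by (auto simp: zero_pairs_def)

lemma zero_pairs_iff:
  assumes "M \<in> cp_cone" shows "{i, j} \<in> zero_pairs M \<longleftrightarrow> i \<noteq> j \<and> M $ i $ j = 0"
  using cp_cone_sym[OF assms] by (auto simp: zero_pairs_def doubleton_eq_iff)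

lemma in_face_cone_zero_pairs: "M \<in> cp_cone \<Longrightarrow> M \<in> face_cone (zero_pairs M)"
  by (auto simp: face_cone_def zero_pairs_iff)

lemma face_cone_scale: "X \<in> face_cone F \<Longrightarrow> 0 \<le> c \<Longrightarrow> c *\<^sub>R X \<in> face_cone F"
  by (simp add: face_cone_def cp_cone_scale)

lemma convex_face_cone: "convex (face_cone F)"
  unfolding convex_def by (auto simp: face_cone_def intro!: cp_cone_scale cp_cone_add)

lemma closed_face_cone: "closed (face_cone F)"
proof -
  have "face_cone F = cp_cone \<inter> {M. \<forall>i j. {i, j} \<in> F \<longrightarrow> M $ i $ j = 0}"
    by (auto simp: face_cone_def)
  moreover have "closed {M :: real^'a^'a. \<forall>i j. {i, j} \<in> F \<longrightarrow> M $ i $ j = 0}"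
    by (intro closed_Collect_all closed_Collect_imp closed_Collect_eq continuous_intros) auto
  ultimately show ?thesis by (simp add: closed_cp_cone closed_Int)
qed

lemma outer_in_face_cone: "x \<in> stable_vecs F \<Longrightarrow> outer x \<in> face_cone F"
  by (auto simp: face_cone_def stable_vecs_def outer_in_cp_cone)

lemma factor_stable:
  assumes "finite I" "\<And>i. i \<in> I \<Longrightarrow> nonneg_vec (x i)" "(\<Sum>i\<in>I. outer (x i)) \<in> face_cone F" "i \<in> I"
  shows "x i \<in> stable_vecs F"
proof -
  have "x i $ k = 0 \<or> x i $ l = 0" if "{k, l} \<in> F" for k l
  proof -
    have "(\<Sum>i\<in>I. x i $ k * x i $ l) = 0" using assms(3) that by (simp add: face_cone_def)
    moreover have "0 \<le> x m $ k * x m $ l" if "m \<in> I" for m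
      using assms(2)[OF that] by (simp add: nonneg_vec_def)
    ultimately have "x i $ k * x i $ l = 0" using assms(1,4) by (simp add: sum_nonneg_eq_0_iff)
    then show ?thesis by simp
  qed
  then show ?thesis using assms(2,4) by (simp add: stable_vecs_def)
qed

text \<open>The face spans all symmetric matrices that vanish at \<open>F\<close>, so for a curve of
  matrices it suffices to check symmetry and the prescribed zeros.\<close>

lemma span_face_cone:
  fixes X :: "real^'n^'n"
  assumes F: "F \<subseteq> pairs" and sym: "\<And>i j. X $ i $ j = X $ j $ i"
    and zF: "\<And>i j. {i, j} \<in> F \<Longrightarrow> X $ i $ j = 0"
  shows "X \<in> span (face_cone F)"
proof -
  \<comment> \<open>By polarization \<open>G i j\<close> is the sum of the matrix units at
    \<open>(i, j)\<close> and \<open>(j, i)\<close>, also for \<open>i = j\<close>; hence the factor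
    1/2 when summing over ordered pairs.\<close>
  define G :: "'n \<Rightarrow> 'n \<Rightarrow> real^'n^'n" where
    "G i j = outer (axis i 1 + axis j 1) - outer (axis i 1) - outer (axis j 1)" for i j
  have sing: "{i} \<notin> F" for i using F pairs_iff[of i i] by auto
  have st: "axis i 1 + axis j 1 \<in> stable_vecs F" if "{i, j} \<notin> F" for i j
    using that sing by (intro stable_clique[of _ "{i, j}"]) (auto simp: nonneg_vec_def axis_def insert_commute)
  have st1: "axis i 1 \<in> stable_vecs F" for i
    using sing by (intro stable_clique[of _ "{i}"]) (auto simp: nonneg_vec_def axis_def)
  have "(X $ i $ j / 2) *\<^sub>R G i j \<in> span (face_cone F)" for i j
  proof (cases "{i, j} \<in> F")
    case False
    then show ?thesis unfolding G_def
      by (intro span_scale span_diff span_base outer_in_face_cone st st1)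
  qed (simp add: zF span_zero)
  then have "(\<Sum>i\<in>UNIV. \<Sum>j\<in>UNIV. (X $ i $ j / 2) *\<^sub>R G i j) \<in> span (face_cone F)"
    by (intro span_sum)
  also have "(\<Sum>i\<in>UNIV. \<Sum>j\<in>UNIV. (X $ i $ j / 2) *\<^sub>R G i j) = X"
  proof -
    have "(\<Sum>i\<in>UNIV. \<Sum>j\<in>UNIV. (X $ i $ j / 2) *\<^sub>R G i j) $ k $ l = X $ k $ l" for k l
    proof -
      have "(\<Sum>i\<in>UNIV. \<Sum>j\<in>UNIV. (X $ i $ j / 2) *\<^sub>R G i j) $ k $ l
        = (\<Sum>i\<in>UNIV. \<Sum>j\<in>UNIV. (if j = l then (if i = k then X $ i $ j / 2 else 0) else 0)
            + (if j = k then (if i = l then X $ i $ j / 2 else 0) else 0))"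
        by (simp add: G_def) (intro sum.cong, auto simp: axis_def algebra_simps)
      also have "\<dots> = X $ k $ l / 2 + X $ l $ k / 2"
        by (simp add: sum.distrib)
      also have "\<dots> = X $ k $ l" using sym[of l k] by simp
      finally show ?thesis .
    qed
    then show ?thesis by (simp add: vec_eq_iff)
  qed
  finally show ?thesis .
qed

lemma face_cone_exit:
  fixes f :: "real \<Rightarrow> real^'n^'n"
  assumes F: "F \<subseteq> pairs" and cont: "continuous_on UNIV f" and f0: "f 0 \<in> face_cone F"
    and sp: "\<And>t. f t \<in> span (face_cone F)" and out: "\<And>t. t > b \<Longrightarrow> f t \<notin> cp_cone"
  obtains s B where "0 \<le> s" "f s \<in> face_cone F" "copositive_on F B" "B \<noteq> 0" "B \<bullet> f s = 0"
    "\<And>i j. {i, j} \<in> F \<Longrightarrow> B $ i $ j = 0"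
proof -
  obtain s where s: "0 \<le> s" "f s \<in> face_cone F" "\<And>t. t > s \<Longrightarrow> f t \<notin> face_cone F"
    using last_exit_time[OF closed_face_cone cont f0, of b] out by (auto simp: face_cone_def)
  have "isCont f s" using cont by (simp add: continuous_on_eq_continuous_at)
  from cone_supporting_functional[OF convex_face_cone face_cone_scale this s(2) sp s(3)]
  obtain a where a: "\<And>X. X \<in> face_cone F \<Longrightarrow> 0 \<le> a \<bullet> X" "a \<bullet> f s = 0" "\<exists>X\<in>face_cone F. 0 < a \<bullet> X"
    by metis
  \<comment> \<open>Symmetrizing \<open>a\<close> and clearing its entries at \<open>F\<close> does
    not change its values on the face.\<close>
  define B :: "real^'n^'n" where "B = (\<chi> i j. if {i, j} \<in> F then 0 else (a $ i $ j + a $ j $ i) / 2)"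
  have symB: "B $ i $ j = B $ j $ i" for i j by (simp add: B_def insert_commute add.commute)
  have eq: "B \<bullet> X = a \<bullet> X" if X: "X \<in> face_cone F" for X
  proof -
    have symX: "X $ i $ j = X $ j $ i" for i j using X cp_cone_sym by (auto simp: face_cone_def)
    have "a \<bullet> X = (\<Sum>i\<in>UNIV. \<Sum>j\<in>UNIV. a $ i $ j * X $ i $ j)" by (simp add: inner_vec_def)
    moreover have "\<dots> = (\<Sum>i\<in>UNIV. \<Sum>j\<in>UNIV. a $ j $ i * X $ i $ j)"
      by (subst sum.swap) (intro sum.cong refl, metis symX)
    moreover have "B \<bullet> X = (\<Sum>i\<in>UNIV. \<Sum>j\<in>UNIV. (a $ i $ j * X $ i $ j + a $ j $ i * X $ i $ j) / 2)"
      unfolding inner_vec_def using X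
      by (intro sum.cong refl) (auto simp: B_def face_cone_def algebra_simps intro!: sum.cong)
    ultimately show ?thesis by (simp add: sum_divide_distrib[symmetric] sum.distrib)
  qed
  show ?thesis
  proof (rule that[OF s(1,2)])
    show "copositive_on F B"
    proof
      fix x assume "x \<in> stable_vecs F"
      then show "0 \<le> qform B x"
        using outer_in_face_cone[of x F] eq a(1) by (metis inner_outer)
    qed (rule symB)
    show "B \<noteq> 0" using a(3) eq by force
    show "B \<bullet> f s = 0" using eq[OF s(2)] a(2) by simp
  qed (auto simp: B_def)
qed

lemma factor_support:
  assumes "(\<Sum>i\<in>I. outer (x i)) $ k $ l \<noteq> 0"
  obtains i where "i \<in> I" "x i $ k \<noteq> 0" "x i $ l \<noteq> 0"
proof -
  have "(\<Sum>i\<in>I. x i $ k * x i $ l) \<noteq> 0" using assms by simp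
  then obtain i where "i \<in> I" "x i $ k * x i $ l \<noteq> 0"
    by (rule sum.not_neutral_contains_not_neutral)
  then show ?thesis using that by simp
qed

lemma factor_zero:
  assumes "finite I" "\<And>i. i \<in> I \<Longrightarrow> 0 \<le> B \<bullet> outer (x i)" "B \<bullet> (\<Sum>i\<in>I. outer (x i)) = 0" "i \<in> I"
  shows "B \<bullet> outer (x i) = 0"
  using assms by (simp add: inner_sum_right sum_nonneg_eq_0_iff)

section \<open>Shears\<close>

definition shear :: "'n \<Rightarrow> 'n \<Rightarrow> real \<Rightarrow> real^'n \<Rightarrow> real^'n" where
  "shear i j s x = (\<chi> k. if k = i then x $ i - s * x $ j else x $ k)"

text \<open>The congruence \<open>P X P^T\<close> with \<open>P = I - s E_ij\<close>, expanded so
  that linearity in \<open>X\<close> and continuity in \<open>s\<close> are visible.\<close>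

definition shear_mat :: "'n \<Rightarrow> 'n \<Rightarrow> real \<Rightarrow> real^'n^'n \<Rightarrow> real^'n^'n" where
  "shear_mat i j s X = X - s *\<^sub>R (\<chi> k l. (if k = i then X $ j $ l else 0) + (if l = i then X $ k $ j else 0))
     + s\<^sup>2 *\<^sub>R (\<chi> k l. if k = i \<and> l = i then X $ j $ j else 0)"

lemma shear_mat_outer: "shear_mat i j s (outer x) = outer (shear i j s x)"
  by (simp add: vec_eq_iff shear_mat_def shear_def power2_eq_square algebra_simps)

lemma shear_mat_add: "shear_mat i j s (X + Y) = shear_mat i j s X + shear_mat i j s Y"
  by (simp add: vec_eq_iff shear_mat_def algebra_simps)

lemma shear_mat_sum: "shear_mat i j s (\<Sum>k\<in>I. f k) = (\<Sum>k\<in>I. shear_mat i j s (f k))"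
proof (induction I rule: infinite_finite_induct)
  case (insert k I)
  then show ?case by (simp add: shear_mat_add)
qed (simp_all add: vec_eq_iff shear_mat_def)

lemma shear_mat_inverse: "i \<noteq> j \<Longrightarrow> shear_mat i j (- s) (shear_mat i j s X) = X"
  by (simp add: vec_eq_iff shear_mat_def power2_eq_square algebra_simps)

lemma continuous_shear_mat: "continuous_on UNIV (\<lambda>s. shear_mat i j s X)"
  unfolding shear_mat_def by (intro continuous_intros)

lemma shear_mat_0 [simp]: "shear_mat i j 0 X = X"
  by (simp add: shear_mat_def)

text \<open>The inverse shear adds \<open>s\<close> times coordinate \<open>j\<close> to coordinate
  \<open>i\<close>, which preserves nonnegativity and the number of summands.\<close>

lemma cp_le_shear:
  assumes "cp_le k (shear_mat i j s M)" "0 \<le> s" "i \<noteq> j"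
  shows "cp_le k M"
proof -
  obtain I x where I: "finite (I::nat set)" "card I \<le> k" "\<And>i. i \<in> I \<Longrightarrow> nonneg_vec (x i)"
    "shear_mat i j s M = (\<Sum>i\<in>I. outer (x i))" by (rule cp_leE[OF assms(1)]) blast
  have "M = shear_mat i j (- s) (\<Sum>i\<in>I. outer (x i))"
    using I(4) shear_mat_inverse[OF assms(3)] by metis
  also have "\<dots> = (\<Sum>m\<in>I. outer (shear i j (- s) (x m)))"
    by (simp add: shear_mat_sum shear_mat_outer)
  finally show ?thesis
  proof (rule cp_leI[OF I(1,2), rotated])
    show "nonneg_vec (shear i j (- s) (x m))" if "m \<in> I" for m
      using I(3)[OF that] assms(2) by (simp add: nonneg_vec_def shear_def)
  qed
qed

text \<open>The entry at \<open>(i, j)\<close> falls linearly with slope \<open>M $ j $ j\<close>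
  and becomes negative.\<close>

lemma shear_mat_exits:
  assumes "i \<noteq> j" "0 < M $ j $ j" "t > M $ i $ j / M $ j $ j"
  shows "shear_mat i j t M \<notin> cp_cone"
proof
  assume "shear_mat i j t M \<in> cp_cone"
  then have "0 \<le> shear_mat i j t M $ i $ j" by (rule cp_cone_nonneg)
  then have "t * M $ j $ j \<le> M $ i $ j" using assms(1) by (simp add: shear_mat_def)
  then show False using assms(2,3) by (simp add: divide_less_eq)
qed

section \<open>The bound for six-dimensional matrices\<close>

lemma nonneg_stable_empty: "nonneg_vec x \<Longrightarrow> x \<in> stable_vecs {}"
  by (simp add: stable_vecs_def)

text \<open>What remains is a symmetric 5 x 5 submatrix with 10 + 5 coordinates.\<close>

lemma cp_le_15_if_degenerate:
  fixes x :: "'i \<Rightarrow> real^'n"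
  assumes n: "CARD('n) = 6" and "finite I" "\<And>i. i \<in> I \<Longrightarrow> nonneg_vec (x i)"
    and v: "v \<noteq> 0" "\<And>i. i \<in> I \<Longrightarrow> v \<bullet> x i = 0"
  shows "cp_le 15 (\<Sum>i\<in>I. outer (x i))"
proof -
  obtain k where k: "v $ k \<noteq> 0" using v(1) by (auto simp: vec_eq_iff)
  show ?thesis
    by (rule cp_le_by_kernel[OF assms(2) _ _ k _ v(2), where F = "{}"])
      (use assms in \<open>auto simp: nonneg_stable_empty choose_two\<close>)
qed

text \<open>A zero pair \<open>{a, b}\<close> saves one more coordinate if \<open>v\<close> is
  nonzero outside it. Otherwise \<open>v\<close> would vanish: each \<open>x i\<close> is zero at
  \<open>a\<close> or at \<open>b\<close>, while some \<open>x i\<close> is nonzero at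
  \<open>a\<close> and some at \<open>b\<close>.\<close>

lemma cp_le_14_if_degenerate:
  fixes x :: "'i \<Rightarrow> real^'n"
  assumes n: "CARD('n) = 6" and I: "finite I" and xF: "\<And>i. i \<in> I \<Longrightarrow> x i \<in> stable_vecs F"
    and F: "F \<subseteq> pairs" "F \<noteq> {}"
    and nz: "\<And>k. \<exists>i\<in>I. x i $ k \<noteq> 0"
    and v: "v \<noteq> 0" "\<And>i. i \<in> I \<Longrightarrow> v \<bullet> x i = 0"
  shows "cp_le 14 (\<Sum>i\<in>I. outer (x i))"
proof -
  obtain s where s: "s \<in> F" using F by blast
  then have "card s = 2" using F by (auto simp: pairs_def)
  then obtain a b where ab: "s = {a, b}" "a \<noteq> b" by (auto simp: card_2_iff)
  have sub: "x i \<in> stable_vecs {{a, b}}" if "i \<in> I" for i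
    using xF[OF that] s ab by (auto simp: stable_vecs_def)
  have "\<exists>k. k \<notin> {a, b} \<and> v $ k \<noteq> 0"
  proof (rule ccontr)
    assume *: "\<not> ?thesis"
    have vx: "v $ a * x i $ a + v $ b * x i $ b = 0" if "i \<in> I" for i
    proof -
      have "v \<bullet> x i = (\<Sum>k\<in>{a, b}. v $ k * x i $ k)"
        unfolding inner_vec_def using * by (intro sum.mono_neutral_cong_right) auto
      then show ?thesis using v(2)[OF that] ab by simp
    qed
    have z: "x i $ a = 0 \<or> x i $ b = 0" if "i \<in> I" for i
      using sub[OF that] by (simp add: stable_vecs_def)
    have "v $ a = 0" using nz[of a] vx z by (metis add.right_neutral mult_eq_0_iff)
    moreover have "v $ b = 0" using nz[of b] vx z by (metis add.left_neutral mult_eq_0_iff)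
    ultimately have "v = 0" using * by (auto simp: vec_eq_iff)
    then show False using v(1) by simp
  qed
  then obtain k where k: "k \<notin> {a, b}" "v $ k \<noteq> 0" by blast
  show ?thesis
    by (rule cp_le_by_kernel[OF I sub _ k(2) _ v(2)]) (use n k ab in \<open>auto simp: choose_two\<close>)
qed

text \<open>A zero \<open>x\<close> of a copositive form satisfies \<open>x $ k * (B *v x) $ k = 0\<close> for every \<open>k\<close>, and these equations
  are linear in \<open>outer x\<close>. Since row \<open>i\<close> of \<open>B\<close> vanishes, they survive the shear of coordinate \<open>i\<close>, which
  therefore leaves the face without leaving its span.\<close>

lemma cp_le_15_copositive_face:
  fixes N :: "real^'n^'n"
  assumes n: "CARD('n) = 6" and "copositive_on {} B" and S: "S = {i. B $ i $ i \<noteq> 0}" "card S = 5"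
    and row: "\<And>i j. i \<notin> S \<Longrightarrow> B $ i $ j = 0"
    and N: "N \<in> cp_cone" "B \<bullet> N = 0"
  shows "cp_le 15 N"
proof -
  interpret copositive_on "{}" B by fact
  have outer0: "0 \<le> B \<bullet> outer x" if "nonneg_vec x" for x
    using pos[OF nonneg_stable_empty[OF that]] by (simp add: inner_outer)
  have BX: "0 \<le> B \<bullet> X" if X: "X \<in> cp_cone" for X
  proof -
    obtain I x where "finite (I::nat set)" "\<And>i. i \<in> I \<Longrightarrow> nonneg_vec (x i)" "X = (\<Sum>i\<in>I. outer (x i))"
      by (rule cp_coneE[OF X]) blast
    then show ?thesis using outer0 by (simp add: inner_sum_right sum_nonneg)
  qed
  define W where "W = {X :: real^'n^'n. (\<forall>i j. X $ i $ j = X $ j $ i) \<and> (\<forall>k\<in>S. (\<Sum>l\<in>UNIV. B $ k $ l * X $ k $ l) = 0)}"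
  define C where "C = cp_cone \<inter> {X. B \<bullet> X = 0}"
  have W: "subspace W"
    unfolding W_def subspace_def by (auto simp: algebra_simps sum.distrib sum_distrib_left[symmetric])
  \<comment> \<open>21 coordinates less the five diagonal ones in \<open>S\<close>.\<close>
  have dW: "dim W \<le> 16"
  proof -
    define D where "D = pairs \<union> (\<lambda>i. {i}) ` (- S)"
    have "dim W \<le> card D"
    proof (rule dim_le_coordinates[OF W])
      fix X assume X: "X \<in> W" and XD: "\<And>i j. {i, j} \<in> D \<Longrightarrow> X $ i $ j = 0"
      have off: "X $ i $ j = 0" if "i \<noteq> j" for i j using XD[of i j] that by (simp add: D_def)
      have "X $ k $ k = 0" for k
      proof (cases "k \<in> S")
        case True
        have "(\<Sum>l\<in>UNIV. B $ k $ l * X $ k $ l) = B $ k $ k * X $ k $ k"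
          using off by (subst sum.remove[of _ k]) auto
        moreover have "(\<Sum>l\<in>UNIV. B $ k $ l * X $ k $ l) = 0" using X True unfolding W_def by blast
        ultimately show ?thesis using True by (simp add: S(1))
      next
        case False
        then show ?thesis using XD[of k k] by (simp add: D_def)
      qed
      then show "X = 0" using off by (metis vec_eq_iff zero_index)
    qed (auto simp: W_def)
    also have "\<dots> \<le> card (pairs :: 'n set set) + card ((\<lambda>i. {i}) ` (- S))"
      unfolding D_def by (rule card_Un_le)
    also have "\<dots> \<le> (CARD('n) choose 2) + card (- S)"
      using card_image_le[of "- S" "\<lambda>i. {i}"] by (simp add: card_pairs)
    also have "card (- S) = 1" using n S(2) by (simp add: Compl_eq_Diff_UNIV card_Diff_subset)
    finally show ?thesis using n by (simp add: choose_two)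
  qed
  have outerC: "outer (x i) \<in> C"
    if "finite I" "\<And>i. i \<in> I \<Longrightarrow> nonneg_vec (x i)" "(\<Sum>i\<in>I. outer (x i)) \<in> C" "i \<in> I"
    for I :: "nat set" and x :: "nat \<Rightarrow> real^'n" and i
  proof -
    have "B \<bullet> outer (x i) = 0"
      by (rule factor_zero[OF that(1) _ _ that(4)]) (use that outer0 in \<open>auto simp: C_def\<close>)
    then show ?thesis using that by (simp add: C_def outer_in_cp_cone)
  qed
  have CW: "C \<subseteq> W"
  proof
    fix X assume X: "X \<in> C"
    then have Xcp: "X \<in> cp_cone" by (simp add: C_def)
    obtain I x where I: "finite (I::nat set)" "\<And>i. i \<in> I \<Longrightarrow> nonneg_vec (x i)" "X = (\<Sum>i\<in>I. outer (x i))"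
      by (rule cp_coneE[OF Xcp]) blast
    have "outer (x i) \<in> W" if i: "i \<in> I" for i
    proof -
      have "qform B (x i) = 0" using outerC[of I x i] X I i by (simp add: C_def inner_outer)
      then have "x i $ k * (B *v x i) $ k = 0" for k
        using gradient_zero[OF nonneg_stable_empty[OF I(2)[OF i]], of k] by auto
      then have "(\<Sum>l\<in>UNIV. B $ k $ l * (x i $ k * x i $ l)) = 0" for k
        by (simp add: matrix_vector_mult_def sum_distrib_left mult.left_commute)
      then show ?thesis by (simp add: W_def mult.commute)
    qed
    then show "X \<in> W" unfolding I(3) by (intro subspace_sum[OF W])
  qed
  then have spW: "span C \<subseteq> W" using W by (simp add: span_minimal)
  \<comment> \<open>All summands of \<open>Y\<close> stay in the face of \<open>C\<close> exposed by
    \<open>a\<close>; so it suffices that this face lies in a subspace of dimension at most 15. The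
    choice \<open>a = 0\<close> exposes all of \<open>C\<close>.\<close>
  have by_subspace: "cp_le 15 Y" if Y: "Y \<in> C" and U: "subspace U" "dim U \<le> 15"
    "\<And>X. X \<in> C \<Longrightarrow> a \<bullet> X = 0 \<Longrightarrow> X \<in> U" "\<And>X. X \<in> C \<Longrightarrow> 0 \<le> a \<bullet> X" "a \<bullet> Y = 0" for Y U a
  proof -
    have Ycp: "Y \<in> cp_cone" using Y by (simp add: C_def)
    obtain I x where I: "finite (I::nat set)" "\<And>i. i \<in> I \<Longrightarrow> nonneg_vec (x i)" "Y = (\<Sum>i\<in>I. outer (x i))"
      by (rule cp_coneE[OF Ycp]) blast
    have oC: "outer (x i) \<in> C" if "i \<in> I" for i
      using outerC[of I x i] Y I that by simp
    have "outer (x i) \<in> U" if "i \<in> I" for i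
    proof -
      have "a \<bullet> outer (x i) = 0"
        by (rule factor_zero[OF I(1) _ _ that]) (use oC U(4,5) I(3) in auto)
      then show ?thesis using U(3)[OF oC[OF that]] by blast
    qed
    then show ?thesis unfolding I(3) using conical_reduction[OF I(1) _ U(1) _ U(2), of x] I(2) by blast
  qed
  have NC: "N \<in> C" using N by (simp add: C_def)
  show ?thesis
  proof (cases "dim (span C) \<le> 15")
    case True
    show ?thesis
      by (rule by_subspace[OF NC subspace_span True, of 0]) (auto simp: span_base)
  next
    case False
    \<comment> \<open>In dimension 16 the span is given by the linear equations of \<open>W\<close>,
      which can be checked along the shear.\<close>
    then have spanW: "span C = W"
      using dW W spW by (intro subspace_dim_equal) auto
    have "S \<noteq> UNIV" using n S(2) by force
    then obtain i where i: "i \<notin> S" by blast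
    have "S \<noteq> {}" using S(2) by auto
    then obtain j where j: "j \<in> S" by blast
    have ij: "i \<noteq> j" using i j by blast
    show ?thesis
    proof (cases "N $ j $ j = 0")
      case True
      obtain I x where I: "finite (I::nat set)" "\<And>i. i \<in> I \<Longrightarrow> nonneg_vec (x i)" "N = (\<Sum>i\<in>I. outer (x i))"
        by (rule cp_coneE[OF N(1)]) blast
      have "(\<Sum>i\<in>I. (x i $ j)\<^sup>2) = 0" using True I(3) by (simp add: power2_eq_square)
      then have "x m $ j = 0" if "m \<in> I" for m using that I(1) by (simp add: sum_nonneg_eq_0_iff)
      then show ?thesis unfolding I(3)
        by (intro cp_le_15_if_degenerate[OF n I(1), where v = "axis j 1"]) (auto intro: I(2) simp: inner_axis' axis_eq_0_iff)
    next
      case False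
      then have Njj: "0 < N $ j $ j" using cp_cone_nonneg[OF N(1), of j j] by simp
      let ?f = "\<lambda>s. shear_mat i j s N"
      have clC: "closed C" unfolding C_def
        by (intro closed_Int closed_cp_cone closed_Collect_eq continuous_intros)
      have outC: "?f t \<notin> C" if "t > N $ i $ j / N $ j $ j" for t
        using shear_mat_exits[OF ij Njj that] by (simp add: C_def)
      have "?f 0 \<in> C" using NC by simp
      from last_exit_time[OF clC continuous_shear_mat this outC]
      obtain s where s: "0 \<le> s" "?f s \<in> C" "\<And>t. t > s \<Longrightarrow> ?f t \<notin> C" by blast
      have fW: "?f t \<in> W" for t
      proof -
        have NW: "N \<in> W" using CW NC by blast
        have symN: "N $ k $ l = N $ l $ k" for k l using cp_cone_sym[OF N(1)] .
        \<comment> \<open>In a row \<open>k \<in> S\<close> the shear changes only the entry at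
          column \<open>i\<close>, where \<open>B\<close> is zero.\<close>
        have same: "B $ k $ l * ?f t $ k $ l = B $ k $ l * N $ k $ l" if "k \<in> S" for k l
        proof (cases "l = i")
          case True
          then show ?thesis using row[OF i] sym[of k l] by simp
        next
          case False
          have "k \<noteq> i" using that i by blast
          then show ?thesis using False by (simp add: shear_mat_def)
        qed
        have "(\<Sum>l\<in>UNIV. B $ k $ l * N $ k $ l) = 0" if "k \<in> S" for k
          using NW that unfolding W_def by blast
        then have "(\<Sum>l\<in>UNIV. B $ k $ l * ?f t $ k $ l) = 0" if "k \<in> S" for k
          using that by (simp only: same[OF that])
        moreover have "?f t $ k $ l = ?f t $ l $ k" for k l
          using symN[of k l] symN[of k j] symN[of j l] by (simp add: shear_mat_def)
        ultimately show ?thesis by (simp add: W_def)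
      qed
      have convC: "convex C" unfolding C_def convex_def
        by (auto intro!: cp_cone_add cp_cone_scale simp: inner_add_right)
      have scaleC: "c *\<^sub>R X \<in> C" if "X \<in> C" "0 \<le> c" for X c
        using that by (simp add: C_def cp_cone_scale)
      have isc: "isCont ?f s" using continuous_shear_mat[of i j N] by (simp add: continuous_on_eq_continuous_at)
      have sp: "?f t \<in> span C" for t using fW spanW by simp
      from cone_supporting_functional[OF convC scaleC isc s(2) sp s(3)]
      obtain a where a: "\<And>X. X \<in> C \<Longrightarrow> 0 \<le> a \<bullet> X" "a \<bullet> ?f s = 0" "\<exists>X\<in>C. 0 < a \<bullet> X"
        by blast
      define U where "U = W \<inter> {X. a \<bullet> X = 0}"
      have U: "subspace U" unfolding U_def
        using W subspace_hyperplane by (rule subspace_inter)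
      \<comment> \<open>A point of \<open>C\<close> off the hyperplane makes \<open>U\<close> a
        proper subspace of \<open>W\<close>; this is the missing equation.\<close>
      obtain X where X: "X \<in> C" "0 < a \<bullet> X" using a(3) by blast
      then have "X \<in> W" "X \<notin> U" using CW by (auto simp: U_def)
      then have "U \<noteq> W" by blast
      moreover have "U = W" if "dim W \<le> dim U"
        using subspace_dim_equal[OF U W _ that] by (auto simp: U_def)
      ultimately have dU: "dim U \<le> 15" using dW by linarith
      have "cp_le 15 (?f s)"
        by (rule by_subspace[OF s(2) U dU _ a(1,2)]) (use CW in \<open>auto simp: U_def\<close>)
      then show ?thesis using cp_le_shear s(1) ij by blast
    qed
  qed
qed

text \<open>The induction runs over the number of pairs that are not zero pairs: a sheared boundary
  matrix with a new zero entry is covered by the hypothesis, while a nonsingular one with the same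
  zeros satisfies \<open>copositive_zeros\<close>.\<close>

theorem cp_le_15:
  fixes M :: "real^'n^'n"
  assumes n: "CARD('n) = 6" and M: "M \<in> cp_cone"
  shows "cp_le 15 M"
  using M
proof (induction "15 - card (zero_pairs M)" arbitrary: M rule: less_induct)
  case less
  define F where "F = zero_pairs M"
  have F: "F \<subseteq> pairs" by (simp add: F_def zero_pairs_subset)
  have pairs15: "card (pairs :: 'n set set) = 15" using n by (simp add: card_pairs choose_two)
  then have F15: "card F \<le> 15" using F by (metis card_mono finite)
  have MF: "M \<in> face_cone F" using less.prems by (simp add: F_def in_face_cone_zero_pairs)
  obtain I x where I: "finite (I::nat set)" "\<And>i. i \<in> I \<Longrightarrow> nonneg_vec (x i)" "M = (\<Sum>i\<in>I. outer (x i))"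
    by (rule cp_coneE[OF less.prems]) blast
  have MI: "(\<Sum>i\<in>I. outer (x i)) \<in> face_cone F" using MF I(3) by simp
  \<comment> \<open>21 is the dimension of the space of symmetric 6 x 6 matrices.\<close>
  have rows: "cp_le d (\<Sum>i\<in>J. outer (y i))"
    if J: "finite J" "\<And>i. i \<in> J \<Longrightarrow> nonneg_vec (y i)" "(\<Sum>i\<in>J. outer (y i)) \<in> face_cone F"
      and b: "\<And>k. k \<in> S \<Longrightarrow> b k $ k \<noteq> 0" "\<And>i k. i \<in> J \<Longrightarrow> k \<in> S \<Longrightarrow> y i $ k * (b k \<bullet> y i) = 0"
      and d: "21 \<le> d + card F + card S" for J :: "nat set" and y :: "nat \<Rightarrow> real^'n" and b S d
    by (rule cp_le_by_rows[OF J(1) factor_stable[OF J] F b]) (use d n in \<open>simp_all add: choose_two\<close>)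
  have sym: "M $ i $ j = M $ j $ i" for i j using cp_cone_sym[OF less.prems] .
  show ?case
  proof (cases "6 \<le> card F \<or> (\<exists>v. v \<noteq> 0 \<and> (\<forall>i\<in>I. v \<bullet> x i = 0))")
    case True
    then show ?thesis
    proof
      assume "6 \<le> card F"
      then show ?thesis unfolding I(3) by (intro rows[OF I(1,2) MI, where S = "{}"]) auto
    next
      assume "\<exists>v. v \<noteq> 0 \<and> (\<forall>i\<in>I. v \<bullet> x i = 0)"
      then show ?thesis unfolding I(3) using cp_le_15_if_degenerate[OF n I(1), of x] I(2) by blast
    qed
  next
    case False
    have diag: "0 < M $ k $ k" for k
    proof -
      have "M $ k $ k \<noteq> 0"
      proof
        assume "M $ k $ k = 0"
        then have "(\<Sum>i\<in>I. (x i $ k)\<^sup>2) = 0" using I(3) by (simp add: power2_eq_square)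
        then have "\<forall>i\<in>I. axis k 1 \<bullet> x i = 0" using I(1) by (simp add: sum_nonneg_eq_0_iff inner_axis')
        moreover have "axis k (1::real) \<noteq> 0" by (simp add: axis_eq_0_iff)
        ultimately show False using False by blast
      qed
      then show ?thesis using cp_cone_nonneg[OF less.prems, of k k] by simp
    qed
    have analysis: "copositive_zeros F B (y ` J)"
      if J: "finite J" "\<And>i. i \<in> J \<Longrightarrow> nonneg_vec (y i)" and N: "(\<Sum>i\<in>J. outer (y i)) \<in> face_cone F"
        "zero_pairs (\<Sum>i\<in>J. outer (y i)) = F"
      and nd: "\<And>v. v \<noteq> 0 \<Longrightarrow> \<exists>i\<in>J. v \<bullet> y i \<noteq> 0"
      and B: "copositive_on F B" "B \<noteq> 0" "B \<bullet> (\<Sum>i\<in>J. outer (y i)) = 0" "\<And>i j. {i, j} \<in> F \<Longrightarrow> B $ i $ j = 0"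
      for J :: "nat set" and y :: "nat \<Rightarrow> real^'n" and B
    proof -
      interpret copositive_on F B by fact
      have st: "y i \<in> stable_vecs F" if "i \<in> J" for i using factor_stable[OF J N(1) that] .
      show ?thesis
      proof
        fix u assume "u \<in> y ` J"
        then obtain i where i: "i \<in> J" "u = y i" by blast
        have "B \<bullet> outer (y i) = 0"
          by (rule factor_zero[OF J(1) _ B(3) i(1)]) (use st pos in \<open>simp add: inner_outer\<close>)
        then show "u \<in> stable_vecs F \<and> qform B u = 0" using st i by (simp add: inner_outer)
      next
        fix i j :: 'n assume "i \<noteq> j" "{i, j} \<notin> F"
        then have "(\<Sum>k\<in>J. outer (y k)) $ i $ j \<noteq> 0"
          using N zero_pairs_iff[of "\<Sum>k\<in>J. outer (y k)" i j] by (simp add: face_cone_def)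
        then obtain k where "k \<in> J" "y k $ i \<noteq> 0" "y k $ j \<noteq> 0" by (rule factor_support)
        then show "\<exists>x\<in>y ` J. x $ i \<noteq> 0 \<and> x $ j \<noteq> 0" by blast
      next
        fix v :: "real^'n" assume "v \<noteq> 0"
        then show "\<exists>x\<in>y ` J. v \<bullet> x \<noteq> 0" using nd by blast
      qed (use F B in auto)
    qed
    show ?thesis
    proof (cases "card F \<le> 2")
      case True
      \<comment> \<open>Two pairs cover at most four of the six indices; shearing a coordinate
        \<open>i\<close> outside them leaves the entries at \<open>F\<close> alone.\<close>
      have "card (\<Union>F) \<le> (\<Sum>s\<in>F. card s)" by (rule card_Union_le_sum_card)
      also have "\<dots> = 2 * card F" using F by (simp add: pairs_def subset_iff)
      finally have "card (\<Union>F) < CARD('n)" using True n by simp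
      then obtain i where i: "i \<notin> \<Union>F" by (metis UNIV_eq_I less_irrefl)
      have "card (UNIV - {i} :: 'n set) \<noteq> 0" using n by (simp add: card_Diff_singleton)
      then have "UNIV - {i} \<noteq> {}" by (metis card.empty)
      then obtain j where "j \<in> UNIV - {i}" by (meson ex_in_conv)
      then have j: "i \<noteq> j" by (simp add: eq_commute)
      let ?f = "\<lambda>s. shear_mat i j s M"
      have nb: "k \<noteq> i \<and> l \<noteq> i" if "{k, l} \<in> F" for k l using i that by blast
      have spf: "?f t \<in> span (face_cone F)" for t
      proof (rule span_face_cone[OF F])
        show "?f t $ k $ l = ?f t $ l $ k" for k l
          using sym[of k l] sym[of k j] sym[of j l] by (simp add: shear_mat_def)
        show "?f t $ k $ l = 0" if "{k, l} \<in> F" for k l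
          using nb[OF that] that MF by (simp add: shear_mat_def face_cone_def)
      qed
      have "?f 0 \<in> face_cone F" using MF by simp
      from face_cone_exit[OF F continuous_shear_mat this spf shear_mat_exits[OF j diag]]
      obtain s B where s: "0 \<le> s" "?f s \<in> face_cone F" and B: "copositive_on F B" "B \<noteq> 0" "B \<bullet> ?f s = 0"
        "\<And>i j. {i, j} \<in> F \<Longrightarrow> B $ i $ j = 0" by blast
      define N where "N = ?f s"
      have Ncp: "N \<in> cp_cone" using s(2) by (simp add: N_def face_cone_def)
      obtain J y where J: "finite (J::nat set)" "\<And>i. i \<in> J \<Longrightarrow> nonneg_vec (y i)" "N = (\<Sum>i\<in>J. outer (y i))"
        by (rule cp_coneE[OF Ncp]) blast
      have NF: "(\<Sum>i\<in>J. outer (y i)) \<in> face_cone F" using s(2) J(3) by (simp add: N_def)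
      have "cp_le 15 N"
      proof (cases "zero_pairs N = F")
        case False
        have "F \<subseteq> zero_pairs N"
        proof
          fix e assume e: "e \<in> F"
          then have "card e = 2" using F by (auto simp: pairs_def)
          then obtain a b where "e = {a, b}" "a \<noteq> b" by (auto simp: card_2_iff)
          then show "e \<in> zero_pairs N" using e s(2) zero_pairs_iff[OF Ncp] by (simp add: N_def face_cone_def)
        qed
        then have "card F < card (zero_pairs N)" using False by (intro psubset_card_mono) auto
        moreover have "card (zero_pairs N) \<le> 15" using zero_pairs_subset pairs15 by (metis card_mono finite)
        ultimately show ?thesis using less.hyps[OF _ Ncp] by (simp add: F_def)
      next
        case NF_eq: True
        show ?thesis
        proof (cases "\<exists>v. v \<noteq> 0 \<and> (\<forall>i\<in>J. v \<bullet> y i = 0)")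
          case True
          then show ?thesis unfolding J(3) using cp_le_15_if_degenerate[OF n J(1), of y] J(2) by blast
        next
          case False
          interpret Z: copositive_zeros F B "y ` J"
            by (rule analysis[OF J(1,2) NF _ _ B(1,2) _ B(4)])
              (use NF_eq False B(3) J(3) in \<open>auto simp: N_def\<close>)
          show ?thesis
          proof (cases "6 \<le> card F + card Z.S")
            case True
            then show ?thesis unfolding J(3)
              by (intro rows[OF J(1,2) NF, where S = Z.S and b = "\<lambda>k. B $ k"])
                (use Z.zeros_row in \<open>auto simp: Z.S_def\<close>)
          next
            case False
            \<comment> \<open>Since \<open>card F + card Z.S\<close> is at most 5 here, these bounds
              leave only \<open>F = {}\<close> with \<open>card Z.S = 5\<close>.\<close>
            have "4 \<le> card Z.S" "card F \<le> 1 \<Longrightarrow> 5 \<le> card Z.S" using Z.card_S by auto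
            then have "card F = 0" "card Z.S = 5" using False \<open>card F \<le> 2\<close> by linarith+
            then have "F = {}" by simp
            then show ?thesis
              using cp_le_15_copositive_face[OF n _ Z.S_def \<open>card Z.S = 5\<close> Z.row_zero Ncp] B(1,3)
              by (simp add: N_def)
          qed
        qed
      qed
      then show ?thesis unfolding N_def using cp_le_shear s(1) j by blast
    next
      case F3: False
      \<comment> \<open>Three to five zero pairs may meet every coordinate, so a diagonal entry is
        lowered instead. Restoring it costs one summand, hence the target 14 for the boundary
        matrix.\<close>
      have "F \<noteq> pairs" using pairs15 False by auto
      then obtain e where e: "e \<in> pairs" "e \<notin> F" using F by blast
      then obtain i j where ij: "e = {i, j}" "i \<noteq> j" by (auto simp: pairs_def card_2_iff)
      let ?E = "outer (axis i 1) :: real^'n^'n"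
      let ?f = "\<lambda>s. M - s *\<^sub>R ?E"
      have E: "?E $ k $ l = (if k = i \<and> l = i then 1 else 0)" for k l by (simp add: axis_def)
      have "{i} \<notin> F" using F pairs_iff[of i i] by auto
      then have spf: "?f t \<in> span (face_cone F)" for t
        using MF by (intro span_diff span_scale span_base outer_in_face_cone stable_clique[of _ "{i}"])
          (auto simp: nonneg_vec_def axis_def)
      have out: "?f t \<notin> cp_cone" if "t > M $ i $ i" for t
        using that cp_cone_nonneg[of "?f t" i i] by (auto simp: axis_def)
      have cont: "continuous_on UNIV ?f" by (intro continuous_intros)
      have "?f 0 \<in> face_cone F" using MF by simp
      from face_cone_exit[OF F cont this spf out]
      obtain s B where s: "0 \<le> s" "?f s \<in> face_cone F" and B: "copositive_on F B" "B \<noteq> 0" "B \<bullet> ?f s = 0"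
        "\<And>i j. {i, j} \<in> F \<Longrightarrow> B $ i $ j = 0" by blast
      define N where "N = ?f s"
      have Ncp: "N \<in> cp_cone" using s(2) by (simp add: N_def face_cone_def)
      obtain J y where J: "finite (J::nat set)" "\<And>i. i \<in> J \<Longrightarrow> nonneg_vec (y i)" "N = (\<Sum>i\<in>J. outer (y i))"
        by (rule cp_coneE[OF Ncp]) blast
      have NF: "(\<Sum>i\<in>J. outer (y i)) \<in> face_cone F" using s(2) J(3) by (simp add: N_def)
      have off: "N $ k $ l = M $ k $ l" if "k \<noteq> l" for k l
        using that by (auto simp: N_def axis_def)
      \<comment> \<open>Only a diagonal entry has changed, so no new zero pair can arise.\<close>
      have NF_eq: "zero_pairs N = F" unfolding F_def zero_pairs_def using off by metis
      \<comment> \<open>The lowered diagonal entry cannot reach 0, since the pair \<open>e\<close>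
        outside \<open>F\<close> keeps \<open>N $ i $ j\<close> nonzero.\<close>
      have nz: "\<exists>m\<in>J. y m $ k \<noteq> 0" for k
      proof (cases "k = i")
        case True
        have "N $ i $ j \<noteq> 0" using e(2) ij zero_pairs_iff[OF Ncp, of i j] NF_eq by simp
        then obtain m where "m \<in> J" "y m $ i \<noteq> 0"
          unfolding J(3) by (rule factor_support)
        then show ?thesis using True by blast
      next
        case False
        then have "N $ k $ k \<noteq> 0" using diag[of k] by (simp add: N_def axis_def)
        then obtain m where "m \<in> J" "y m $ k \<noteq> 0"
          unfolding J(3) by (rule factor_support)
        then show ?thesis by blast
      qed
      have "cp_le 14 N"
      proof (cases "\<exists>v. v \<noteq> 0 \<and> (\<forall>i\<in>J. v \<bullet> y i = 0)")
        case True
        then obtain v where "v \<noteq> 0" "\<And>i. i \<in> J \<Longrightarrow> v \<bullet> y i = 0" by blast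
        moreover have "F \<noteq> {}" using F3 by auto
        ultimately show ?thesis unfolding J(3)
          using cp_le_14_if_degenerate[OF n J(1), of y F v] factor_stable[OF J(1,2) NF] F nz by blast
      next
        case False
        interpret Z: copositive_zeros F B "y ` J"
          by (rule analysis[OF J(1,2) NF _ _ B(1,2) _ B(4)])
            (use NF_eq False B(3) J(3) in \<open>auto simp: N_def\<close>)
        \<comment> \<open>At least three zero pairs and four row equations: 21 - 7 = 14.\<close>
        have "7 \<le> card F + card Z.S" using Z.card_S(1) F3 by linarith
        then show ?thesis unfolding J(3)
          by (intro rows[OF J(1,2) NF, where S = Z.S and b = "\<lambda>k. B $ k"])
            (use Z.zeros_row in \<open>auto simp: Z.S_def\<close>)
      qed
      moreover have "cp_le 1 (s *\<^sub>R ?E)"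
        using s(1) by (intro cp_le_scale cp_le_outer) (auto simp: nonneg_vec_def axis_def)
      ultimately have "cp_le (14 + 1) (N + s *\<^sub>R ?E)" by (rule cp_le_add)
      then show ?thesis by (simp add: N_def)
    qed
  qed
qed

section \<open>Transfer to matrices with explicit dimensions\<close>

lemma gram_index:
  assumes "i < dim_row V" "k < dim_row V"
  shows "(V * transpose_mat V) $$ (i, k) = (\<Sum>j\<in>{0..<dim_col V}. V $$ (i, j) * (V $$ (k, j) :: real))"
  using assms by (simp add: scalar_prod_def)

lemma fifteen_column_factorization:
  assumes M: "M \<in> carrier_mat 6 6" "completely_positive M"
  obtains V where "nonneg_mat V" "dim_col V = 15" "M = V * transpose_mat V"
proof -
  obtain h where h: "bij_betw h {0..<6::nat} (UNIV :: 6 set)"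
    using ex_bij_betw_nat_finite[of "UNIV :: 6 set"] by auto
  define g where "g = the_inv_into {0..<6} h"
  have gh: "g (h i) = i" if "i < 6" for i
    using h that unfolding g_def by (intro the_inv_into_f_f) (auto simp: bij_betw_def)
  have g6: "g a < 6" for a
  proof -
    have "g a \<in> {0..<6}" unfolding g_def
      using h by (intro the_inv_into_into[OF _ _ subset_refl]) (auto simp: bij_betw_def)
    then show ?thesis by simp
  qed
  obtain W where W: "nonneg_mat W" "M = W * transpose_mat W"
    using M(2) by (auto simp: completely_positive_def)
  have dW: "dim_row W = 6" using M(1) W(2) by auto
  define x :: "nat \<Rightarrow> real^6" where "x j = (\<chi> a. W $$ (g a, j))" for j
  define M' where "M' = (\<Sum>j\<in>{0..<dim_col W}. outer (x j))"
  have M': "M' $ h i $ h k = M $$ (i, k)" if "i < 6" "k < 6" for i k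
    using that dW by (simp add: M'_def x_def gh W(2) gram_index del: index_mult_mat)
  have "M' \<in> cp_cone" unfolding M'_def
    using W(1) g6 dW by (intro cp_cone_sum outer_in_cp_cone) (auto simp: nonneg_vec_def x_def nonneg_mat_def)
  then have "cp_le 15 M'" by (intro cp_le_15) auto
  then obtain I y where I: "finite (I::nat set)" "card I \<le> 15" "\<And>i. i \<in> I \<Longrightarrow> nonneg_vec (y i)"
    "M' = (\<Sum>i\<in>I. outer (y i))" by (rule cp_leE) blast
  obtain e where e: "bij_betw e {0..<card I} I" using ex_bij_betw_nat_finite[OF I(1)] by blast
  \<comment> \<open>Unoccupied columns are filled with zeros, which leaves the product unchanged and
    makes the number of columns exactly 15.\<close>
  define V where "V = Matrix.mat 6 15 (\<lambda>(i, j). if j < card I then y (e j) $ h i else 0)"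
  have "nonneg_mat V"
    using I(3) bij_betwE[OF e] by (auto simp: nonneg_mat_def V_def nonneg_vec_def)
  moreover have "M = V * transpose_mat V"
  proof (rule eq_matI)
    fix i k assume "i < dim_row (V * transpose_mat V)" "k < dim_col (V * transpose_mat V)"
    then have ik: "i < 6" "k < 6" by (auto simp: V_def)
    have "(V * transpose_mat V) $$ (i, k) = (\<Sum>j\<in>{0..<15}. V $$ (i, j) * V $$ (k, j))"
      using ik by (subst gram_index) (auto simp: V_def)
    also have "\<dots> = (\<Sum>j\<in>{0..<card I}. y (e j) $ h i * y (e j) $ h k)"
      using I(2) ik by (intro sum.mono_neutral_cong_right) (auto simp: V_def)
    also have "\<dots> = (\<Sum>m\<in>I. y m $ h i * y m $ h k)"
      by (rule sum.reindex_bij_betw[OF e])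
    also have "\<dots> = M $$ (i, k)" using M'[OF ik] I(4) by simp
    finally show "M $$ (i, k) = (V * transpose_mat V) $$ (i, k)" by simp
  qed (use M(1) in \<open>auto simp: V_def\<close>)
  ultimately show ?thesis using that by (simp add: V_def)
qed

theorem theorem6p1:
  shows "(\<forall>M \<in> carrier_mat 6 6. completely_positive M \<longrightarrow> cp_rank M \<le> 15) \<and> max_cp_rank 6 \<le> 15"
proof -
  have le: "cp_rank M \<le> 15" if M: "M \<in> carrier_mat 6 6" "completely_positive M" for M
  proof -
    obtain V where V: "nonneg_mat V" "dim_col V = 15" "M = V * transpose_mat V"
      by (rule fifteen_column_factorization[OF M])
    then have "(LEAST k. \<exists>V. nonneg_mat V \<and> dim_col V = k \<and> M = V * transpose_mat V) \<le> 15"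
      by (intro Least_le exI[of _ V]) simp
    then show ?thesis by (simp add: cp_rank_def)
  qed
  let ?R = "{cp_rank M | M. M \<in> carrier_mat 6 6 \<and> completely_positive M}"
  \<comment> \<open>The bound makes the set finite, so \<open>Max\<close> is a genuine maximum; the
    zero matrix, as a product with no columns, makes it nonempty.\<close>
  have sub: "?R \<subseteq> {..15}" using le by auto
  have "completely_positive (0\<^sub>m 6 6)"
    unfolding completely_positive_def
    by (intro exI[of _ "0\<^sub>m 6 0"]) (auto simp: nonneg_mat_def scalar_prod_def intro!: eq_matI)
  then have "?R \<noteq> {}" using zero_carrier_mat by blast
  moreover have "finite ?R" using sub finite_subset by blast
  ultimately have "Max ?R \<le> 15" using sub by (subst Max_le_iff) auto
  then show ?thesis using le by (simp add: max_cp_rank_def)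
qed

end
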